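(* Let $G \in \mathscr{S}$. (i) If a non-trivial compact locally normal subgroup of $G$ is a pro-$\pi$ group for some set of primes $\pi$, then every compact open subgroup of $G$ is virtually pro-$\pi$. In particular, for all $p \in \eta(G)$, each closed locally normal subgroup $L \neq \{1\}$ of $G$ has an infinite pro-$p$ subgroup. (ii) If a non-trivial compact locally normal subgroup of $G$ is prosoluble, then every compact open subgroup of $G$ is virtually prosoluble.
   Context: $\mathscr{S}$ is the class of non-discrete, compactly generated, topologically simple, totally disconnected locally compact groups (topologically simple: non-trivial, and the only closed normal subgroups are $\{1\}$ and the whole group). A subgroup of a topological group $G$ is locally normal in $G$ if its normaliser in $G$ is open. The local prime content $\eta(G)$ of a totally disconnected locally compact group $G$ is the set of primes $p$ for which $G$ contains an infinite (compact) pro-$p$ subgroup. A profinite group is virtually pro-$\pi$ (resp. virtually prosoluble) if it has an open pro-$\pi$ (resp. prosoluble) subgroup. *)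

theory Defs
  imports
    "HOL-Analysis.Analysis"
    "HOL-Algebra.Group_Action"
    "HOL-Algebra.Solvable_Groups"
    "HOL-Computational_Algebra.Primes"
begin

text \<open>
  A topological group is a group \<open>G\<close> together with a topology \<open>T\<close> on its carrier.  A subgroup
  \<open>H\<close> is regarded as the topological group given by \<open>G\<lparr>carrier := H\<rparr>\<close> and
  \<open>subtopology T H\<close>.
\<close>

locale topological_group = group G for G (structure) +
  fixes T :: "'a topology"
  assumes topspace_eq: "topspace T = carrier G"
    and continuous_mult: "continuous_map (prod_topology T T) T (\<lambda>(x, y). x \<otimes> y)"
    and continuous_inv: "continuous_map T T (\<lambda>x. inv\<^bsub>G\<^esub> x)"

definition totally_disconnected_space :: "'a topology \<Rightarrow> bool" where
  "totally_disconnected_space T \<longleftrightarrow> (\<forall>C \<in> connected_components_of T. \<exists>x. C = {x})"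

text \<open>Locally compact groups and profinite groups are Hausdorff by convention.\<close>

locale tdlc_group = topological_group +
  assumes Hausdorff: "Hausdorff_space T"
    and locally_compact: "locally_compact_space T"
    and totally_disconnected: "totally_disconnected_space T"

locale profinite_group = topological_group +
  assumes Hausdorff: "Hausdorff_space T"
    and compact: "compact_space T"
    and totally_disconnected: "totally_disconnected_space T"

definition compactly_generated :: "('a, 'b) monoid_scheme \<Rightarrow> 'a topology \<Rightarrow> bool" where
  "compactly_generated G T \<longleftrightarrow> (\<exists>K. compactin T K \<and> generate G K = carrier G)"

definition topologically_simple :: "('a, 'b) monoid_scheme \<Rightarrow> 'a topology \<Rightarrow> bool" where
  "topologically_simple G T \<longleftrightarrow>
     carrier G \<noteq> {\<one>\<^bsub>G\<^esub>} \<and>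
     (\<forall>N. N \<lhd> G \<and> closedin T N \<longrightarrow> N = {\<one>\<^bsub>G\<^esub>} \<or> N = carrier G)"

locale class_S = tdlc_group +
  assumes non_discrete: "T \<noteq> discrete_topology (carrier G)"
    and compactly_generated: "compactly_generated G T"
    and topologically_simple: "topologically_simple G T"

definition locally_normal :: "('a, 'b) monoid_scheme \<Rightarrow> 'a topology \<Rightarrow> 'a set \<Rightarrow> bool" where
  "locally_normal G T L \<longleftrightarrow> subgroup L G \<and> openin T (normalizer G L)"

text \<open>
  For a class \<open>C\<close> of finite groups closed under quotients (as are the two classes below), a
  profinite group is an inverse limit of \<open>C\<close>-groups iff all its quotients by open normal
  subgroups are \<open>C\<close>-groups.
\<close>

definition pro_class ::
    "('a set monoid \<Rightarrow> bool) \<Rightarrow> ('a, 'b) monoid_scheme \<Rightarrow> 'a topology \<Rightarrow> bool" where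
  "pro_class C G T \<longleftrightarrow>
     profinite_group G T \<and> (\<forall>N. N \<lhd> G \<and> openin T N \<longrightarrow> C (G Mod N))"

definition finite_pi_group :: "nat set \<Rightarrow> ('a, 'b) monoid_scheme \<Rightarrow> bool" where
  "finite_pi_group \<pi> G \<longleftrightarrow>
     group G \<and> finite (carrier G) \<and> (\<forall>p. prime p \<and> p dvd order G \<longrightarrow> p \<in> \<pi>)"

definition finite_soluble_group :: "('a, 'b) monoid_scheme \<Rightarrow> bool" where
  "finite_soluble_group G \<longleftrightarrow> group G \<and> finite (carrier G) \<and> solvable G"

definition pro_pi :: "nat set \<Rightarrow> ('a, 'b) monoid_scheme \<Rightarrow> 'a topology \<Rightarrow> bool" where
  "pro_pi \<pi> = pro_class (finite_pi_group \<pi>)"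

definition prosoluble :: "('a, 'b) monoid_scheme \<Rightarrow> 'a topology \<Rightarrow> bool" where
  "prosoluble = pro_class finite_soluble_group"

definition virtually ::
    "(('a, 'b) monoid_scheme \<Rightarrow> 'a topology \<Rightarrow> bool) \<Rightarrow>
     ('a, 'b) monoid_scheme \<Rightarrow> 'a topology \<Rightarrow> bool" where
  "virtually P G T \<longleftrightarrow>
     (\<exists>H. subgroup H G \<and> openin T H \<and> P (G\<lparr>carrier := H\<rparr>) (subtopology T H))"

definition local_prime_content :: "('a, 'b) monoid_scheme \<Rightarrow> 'a topology \<Rightarrow> nat set" where
  "local_prime_content G T =
     {p. prime p \<and>
         (\<exists>P. subgroup P G \<and> infinite P \<and> pro_pi {p} (G\<lparr>carrier := P\<rparr>) (subtopology T P))}"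

end

theory Submission
  imports Defs "HOL-Algebra.Zassenhaus" "HOL-Algebra.Sylow" "HOL-Algebra.Multiplicative_Group"
begin

text \<open>
  Fix a class of finite groups closed under subgroups, quotients and extensions, and let \<open>L\<close> be a
  non-trivial compact locally normal subgroup that is pro-(this class).  The normal closure of \<open>L\<close> is
  dense, so \<open>G\<close> is generated by a compact open subgroup \<open>U\<close> together with finitely many elements
  \<open>a\<close>, each lying in a conjugate \<open>K\<close> of \<open>L\<close>.  If \<open>W\<close> is a small enough open normal subgroup
  of \<open>U\<close>, then \<open>W\<close> and \<open>a W a\<^sup>-\<^sup>1\<close> are both normal in one and the same compact open group
  \<open>X = W (K \<inter> C)\<close>, with quotients in the class.  As the class is closed under extensions, \<open>W\<close>,
  \<open>X\<close> and \<open>a W a\<^sup>-\<^sup>1\<close> have the same residual.  Hence the residual of \<open>W\<close> is normalised by a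
  generating set of \<open>G\<close>; being compact and normal it is trivial, so \<open>W\<close> is pro-(the class).

  For the statement on \<open>\<eta>(G)\<close>: if \<open>L\<close> had only finite pro-\<open>p\<close> subgroups, then a Sylow
  pro-\<open>p\<close> subgroup of \<open>L \<inter> U\<close> would be finite, so some non-trivial compact locally normal
  subgroup of \<open>L\<close> would be pro-\<open>p'\<close>, and every pro-\<open>p\<close> subgroup of \<open>G\<close> would be finite.
\<close>

section \<open>Conjugation\<close>

text \<open>No open subgroup \<open>W\<close> of \<open>U\<close> can be normalised by every
  generator, as compact normal subgroups are trivial and \<open>G\<close> is not discrete. The
  residual is used instead because it does not change when \<open>W\<close> is replaced by a compact
  open overgroup in which it is normal with quotient in the class. So each generator may bring its
  own \<open>X\<close>, and still all of them fix the same residual.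

  Local normality enters in making \<open>X\<close> invariant under \<open>K\<close>: for
  \<open>w\<close> in \<open>W\<close> and \<open>k\<close> in \<open>K\<close> the commutator lies
  in \<open>K\<close> because \<open>W\<close> normalises \<open>K\<close>, and in \<open>C\<close>
  because \<open>K\<close> normalises \<open>C\<close>. Hence \<open>C\<close> is the core under
  \<open>K\<close> of an open group inside \<open>U\<close> and the normaliser of \<open>K\<close>.

  Membership of a quotient in the class is a relation on subsets of \<open>G\<close>, tested by
  exponents or by derived series, so the main argument compares subgroups of one group and forms no
  quotients.

  For \<open>\<eta>(G)\<close> the locally normal subgroup is shrunk to a pro-\<open>p'\<close>
  piece, which must not vanish. This takes a separate commutator argument: non-trivial locally
  normal subgroups meet every compact open subgroup non-trivially.\<close>

definition conjugation :: "('a, 'b) monoid_scheme \<Rightarrow> 'a \<Rightarrow> 'a \<Rightarrow> 'a" where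
  "conjugation G g x = g \<otimes>\<^bsub>G\<^esub> x \<otimes>\<^bsub>G\<^esub> inv\<^bsub>G\<^esub> g"

context group
begin

abbreviation cj :: "'a \<Rightarrow> 'a \<Rightarrow> 'a" where "cj \<equiv> conjugation G"

lemma cj_closed [simp]: "g \<in> carrier G \<Longrightarrow> x \<in> carrier G \<Longrightarrow> cj g x \<in> carrier G"
  by (simp add: conjugation_def)

lemma cj_cj: "g \<in> carrier G \<Longrightarrow> h \<in> carrier G \<Longrightarrow> x \<in> carrier G \<Longrightarrow> cj g (cj h x) = cj (g \<otimes> h) x"
  by (simp add: conjugation_def inv_mult_group m_assoc)

lemma cj_one [simp]: "x \<in> carrier G \<Longrightarrow> cj \<one> x = x"
  by (simp add: conjugation_def)

lemma cj_hom: "g \<in> carrier G \<Longrightarrow> group_hom G G (cj g)"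
  by (unfold_locales) (auto simp: hom_def conjugation_def m_assoc, simp add: m_assoc[symmetric])

lemma cj_cancel [simp]:
  assumes "g \<in> carrier G" "x \<in> carrier G"
  shows "cj (inv g) (cj g x) = x" "cj g (cj (inv g) x) = x"
  using assms by (simp_all add: cj_cj)

lemma cj_image_cj:
  assumes "g \<in> carrier G" "h \<in> carrier G" "S \<subseteq> carrier G"
  shows "cj g ` cj h ` S = cj (g \<otimes> h) ` S"
  unfolding image_image using assms by (intro image_cong) (auto simp: cj_cj)

lemma cj_image_one [simp]: "S \<subseteq> carrier G \<Longrightarrow> cj \<one> ` S = S"
  by (force simp: image_iff)

lemma cj_image_subset: "g \<in> carrier G \<Longrightarrow> S \<subseteq> carrier G \<Longrightarrow> cj g ` S \<subseteq> carrier G"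
  by auto

lemma cj_image_inv [simp]:
  assumes "g \<in> carrier G" "S \<subseteq> carrier G"
  shows "cj (inv g) ` cj g ` S = S" "cj g ` cj (inv g) ` S = S"
  using assms by (simp_all add: cj_image_cj)

lemma mem_cj_image:
  assumes "g \<in> carrier G" "S \<subseteq> carrier G" "x \<in> carrier G"
  shows "x \<in> cj g ` S \<longleftrightarrow> cj (inv g) x \<in> S"
proof
  assume "cj (inv g) x \<in> S"
  moreover have "x = cj g (cj (inv g) x)" using assms by simp
  ultimately show "x \<in> cj g ` S" by blast
next
  assume "x \<in> cj g ` S"
  then obtain s where "s \<in> S" "x = cj g s" by auto
  then show "cj (inv g) x \<in> S" using assms by (auto simp: subsetD)
qed

lemma cj_image_subgroup: "g \<in> carrier G \<Longrightarrow> subgroup H G \<Longrightarrow> subgroup (cj g ` H) G"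
  using group_hom.subgroup_img_is_subgroup[OF cj_hom] by blast

text \<open>Applying the inclusion to the inverse of \<open>k\<close> gives the reverse one, so a
  single inclusion is all that has to be checked for invariance under a subgroup.\<close>

lemma cj_image_normalised:
  assumes K: "subgroup K G" and "S \<subseteq> carrier G" and sub: "\<And>k. k \<in> K \<Longrightarrow> cj k ` S \<subseteq> S" and k: "k \<in> K"
  shows "cj k ` S = S"
proof
  have kc: "k \<in> carrier G" "inv k \<in> K" using K k by (auto simp: subgroup.mem_carrier subgroup.m_inv_closed)
  have "cj k ` cj (inv k) ` S \<subseteq> cj k ` S" using sub[OF kc(2)] by blast
  then show "S \<subseteq> cj k ` S" using kc assms(2) by simp
qed (use assms in auto)

lemma cj_image_self: "subgroup K G \<Longrightarrow> k \<in> K \<Longrightarrow> cj k ` K = K"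
  by (rule cj_image_normalised[of K])
     (auto simp: subgroup.subset conjugation_def subgroup.m_closed subgroup.m_inv_closed)

lemma normal_in_subgroup_iff:
  assumes "subgroup X G" "subgroup N G"
  shows "N \<lhd> G\<lparr>carrier := X\<rparr> \<longleftrightarrow> N \<subseteq> X \<and> (\<forall>x\<in>X. cj x ` N \<subseteq> N)"
proof -
  interpret X: group "G\<lparr>carrier := X\<rparr>" by (rule subgroup_imp_group[OF assms(1)])
  have inv: "inv\<^bsub>G\<lparr>carrier := X\<rparr>\<^esub> x = inv x" if "x \<in> X" for x
    by (rule m_inv_consistent[OF assms(1) that])
  have "subgroup N (G\<lparr>carrier := X\<rparr>) \<longleftrightarrow> N \<subseteq> X"
    using subgroup_incl[OF assms(2,1)] subgroup.subset[of N "G\<lparr>carrier := X\<rparr>"] by auto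
  then show ?thesis
    unfolding X.normal_inv_iff using inv by (auto simp: conjugation_def image_subset_iff)
qed

lemma subgroup_restrict: "subgroup H G \<Longrightarrow> subgroup K G \<Longrightarrow> subgroup K (G\<lparr>carrier := H\<rparr>) \<longleftrightarrow> K \<subseteq> H"
  using subgroup_incl subgroup.subset by fastforce

lemma subgroup_restrictD: "subgroup H G \<Longrightarrow> subgroup K (G\<lparr>carrier := H\<rparr>) \<Longrightarrow> subgroup K G"
  using incl_subgroup by blast

lemma normaliser_subgroup:
  assumes "S \<subseteq> carrier G"
  shows "subgroup {g \<in> carrier G. cj g ` S = S} G"
proof (rule subgroupI)
  show "inv a \<in> {g \<in> carrier G. cj g ` S = S}" if "a \<in> {g \<in> carrier G. cj g ` S = S}" for a
    using that assms cj_image_inv(1)[of a S] by auto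
  show "a \<otimes> b \<in> {g \<in> carrier G. cj g ` S = S}"
    if "a \<in> {g \<in> carrier G. cj g ` S = S}" "b \<in> {g \<in> carrier G. cj g ` S = S}" for a b
    using that assms cj_image_cj[of a b S] by auto
  show "{g \<in> carrier G. cj g ` S = S} \<noteq> {}"
    using cj_image_one[OF assms] by blast
qed auto

lemma normalizer_eq:
  assumes "S \<subseteq> carrier G"
  shows "normalizer G S = {g \<in> carrier G. cj g ` S = S}"
proof -
  have "l_coset G g S #> inv g = cj g ` S" for g
    unfolding l_coset_def r_coset_def conjugation_def by blast
  then show ?thesis
    using assms unfolding normalizer_def stabilizer_def by simp
qed

end

section \<open>Open subgroups of topological groups\<close>

context topological_group
begin

lemma continuous_map_mult_left: "g \<in> carrier G \<Longrightarrow> continuous_map T T (\<lambda>x. g \<otimes> x)"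
  using continuous_map_compose[OF _ continuous_mult, of T "\<lambda>x. (g, x)"]
  by (simp add: continuous_map_pairwise o_def topspace_eq)

lemma continuous_map_mult_right: "g \<in> carrier G \<Longrightarrow> continuous_map T T (\<lambda>x. x \<otimes> g)"
  using continuous_map_compose[OF _ continuous_mult, of T "\<lambda>x. (x, g)"]
  by (simp add: continuous_map_pairwise o_def topspace_eq)

lemma continuous_map_cj: "g \<in> carrier G \<Longrightarrow> continuous_map T T (cj g)"
proof -
  assume g: "g \<in> carrier G"
  then have "continuous_map T T ((\<lambda>x. x \<otimes> inv g) \<circ> (\<lambda>x. g \<otimes> x))"
    by (intro continuous_map_compose[of T T]) (auto intro: continuous_map_mult_left continuous_map_mult_right)
  then show ?thesis by (simp add: o_def conjugation_def[abs_def])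
qed

lemma openin_carrier: "openin T S \<Longrightarrow> S \<subseteq> carrier G"
  using openin_subset topspace_eq by metis

lemma compactin_carrier: "compactin T S \<Longrightarrow> S \<subseteq> carrier G"
  using compactin_subset_topspace topspace_eq by metis

lemma openin_cj_image:
  assumes "g \<in> carrier G" "openin T S"
  shows "openin T (cj g ` S)"
proof -
  have "cj g ` S = {x \<in> topspace T. cj (inv g) x \<in> S}"
    using assms openin_carrier[OF assms(2)] by (force simp: topspace_eq mem_cj_image)
  then show ?thesis
    using openin_continuous_map_preimage[OF continuous_map_cj[of "inv g"] assms(2)] assms(1) by simp
qed

lemma compactin_cj_image: "g \<in> carrier G \<Longrightarrow> compactin T S \<Longrightarrow> compactin T (cj g ` S)"
  using image_compactin continuous_map_cj by metis

lemma mem_translate: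
  assumes "g \<in> carrier G" "S \<subseteq> carrier G" "x \<in> carrier G"
  shows "x \<in> (\<otimes>) g ` S \<longleftrightarrow> inv g \<otimes> x \<in> S"
proof
  assume "inv g \<otimes> x \<in> S"
  moreover have "x = g \<otimes> (inv g \<otimes> x)" using assms by (simp add: m_assoc[symmetric])
  ultimately show "x \<in> (\<otimes>) g ` S" by blast
next
  assume "x \<in> (\<otimes>) g ` S"
  then obtain s where "s \<in> S" "x = g \<otimes> s" by auto
  then show "inv g \<otimes> x \<in> S" using assms by (auto simp: m_assoc[symmetric] subsetD)
qed

lemma openin_translate:
  assumes "g \<in> carrier G" "openin T S"
  shows "openin T ((\<otimes>) g ` S)"
proof -
  have "(\<otimes>) g ` S = {x \<in> topspace T. inv g \<otimes> x \<in> S}"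
    using assms openin_carrier[OF assms(2)] mem_translate[of g S]
    by (auto simp: topspace_eq m_assoc[symmetric] subsetD)
  then show ?thesis
    using openin_continuous_map_preimage[OF continuous_map_mult_left[of "inv g"] assms(2)] assms(1) by simp
qed

lemma openin_subgroupI:
  assumes H: "subgroup H G" and S: "openin T S" "S \<subseteq> H" "\<one> \<in> S"
  shows "openin T H"
proof -
  have "H = (\<Union>h\<in>H. (\<otimes>) h ` S)"
  proof
    show "H \<subseteq> (\<Union>h\<in>H. (\<otimes>) h ` S)"
      using S(3) subgroup.mem_carrier[OF H] by (force simp: image_iff)
    show "(\<Union>h\<in>H. (\<otimes>) h ` S) \<subseteq> H"
      using S(2) subgroup.m_closed[OF H] by (auto simp: image_iff)
  qed
  moreover have "openin T (\<Union>h\<in>H. (\<otimes>) h ` S)"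
    using S(1) subgroup.mem_carrier[OF H] by (intro openin_Union) (auto intro: openin_translate)
  ultimately show ?thesis by simp
qed

lemma closedin_open_subgroup:
  assumes H: "subgroup H G" and "openin T H"
  shows "closedin T H"
proof -
  have "carrier G - H = (\<Union>g\<in>carrier G - H. (\<otimes>) g ` H)"
  proof
    show "carrier G - H \<subseteq> (\<Union>g\<in>carrier G - H. (\<otimes>) g ` H)"
      using subgroup.one_closed[OF H] by (force simp: image_iff)
    show "(\<Union>g\<in>carrier G - H. (\<otimes>) g ` H) \<subseteq> carrier G - H"
    proof
      fix x assume "x \<in> (\<Union>g\<in>carrier G - H. (\<otimes>) g ` H)"
      then obtain g h where g: "g \<in> carrier G" "g \<notin> H" and h: "h \<in> H" "x = g \<otimes> h" by auto
      have "x \<notin> H"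
      proof
        assume "x \<in> H"
        then have "x \<otimes> inv h \<in> H"
          using h subgroup.m_closed[OF H] subgroup.m_inv_closed[OF H] by blast
        moreover have "x \<otimes> inv h = g"
          using g h subgroup.mem_carrier[OF H] by (simp add: m_assoc)
        ultimately show False using g by simp
      qed
      then show "x \<in> carrier G - H"
        using g h subgroup.mem_carrier[OF H] by auto
    qed
  qed
  moreover have "openin T (\<Union>g\<in>carrier G - H. (\<otimes>) g ` H)"
    using assms by (intro openin_Union) (auto intro: openin_translate)
  ultimately have "openin T (topspace T - H)" using topspace_eq by simp
  then show ?thesis
    using openin_carrier[OF assms(2)] by (simp add: closedin_def topspace_eq)
qed

lemma compactin_open_cosets:
  assumes K: "compactin T K" and V: "openin T V" "\<one> \<in> V"
  obtains F where "finite F" "F \<subseteq> K" "K \<subseteq> (\<Union>f\<in>F. (\<otimes>) f ` V)"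
proof -
  have Kc: "K \<subseteq> carrier G" by (rule compactin_carrier[OF K])
  have cov: "K \<subseteq> \<Union>((\<lambda>k. (\<otimes>) k ` V) ` K)"
    using V(2) Kc by (force simp: image_iff)
  obtain \<F> where \<F>: "finite \<F>" "\<F> \<subseteq> (\<lambda>k. (\<otimes>) k ` V) ` K" "K \<subseteq> \<Union>\<F>"
    using compactinD[OF K _ cov] V(1) Kc openin_translate by blast
  then obtain F where "F \<subseteq> K" "finite F" "\<F> = (\<lambda>k. (\<otimes>) k ` V) ` F"
    by (meson finite_subset_image)
  then show ?thesis using that \<F> by blast
qed

text \<open>For subgroups \<open>K\<close> and \<open>V\<close> this is the largest subgroup of
  \<open>V\<close> normalised by \<open>K\<close>. \<open>V\<close> need not lie in
  \<open>K\<close>, so \<open>K\<close> may be compact without being open.\<close>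

definition core :: "'a set \<Rightarrow> 'a set \<Rightarrow> 'a set" where
  "core K V = (\<Inter>k\<in>K. cj k ` V)"

text \<open>The conjugate of \<open>V\<close> by \<open>k\<close> depends only on the coset of
  \<open>k\<close> modulo \<open>V\<close>, and finitely many open cosets cover the compact set
  \<open>K\<close>. This is what keeps cores open.\<close>

lemma core_finite:
  assumes K: "compactin T K" and V: "openin T V" "subgroup V G"
  obtains F where "finite F" "F \<subseteq> K" "core K V = (\<Inter>k\<in>F. cj k ` V)"
proof -
  obtain F where F: "finite F" "F \<subseteq> K" "K \<subseteq> (\<Union>f\<in>F. (\<otimes>) f ` V)"
    using compactin_open_cosets[OF K V(1) subgroup.one_closed[OF V(2)]] .
  have Kc: "K \<subseteq> carrier G" by (rule compactin_carrier[OF K])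
  have "\<exists>f\<in>F. cj k ` V = cj f ` V" if k: "k \<in> K" for k
  proof -
    obtain f v where f: "f \<in> F" "v \<in> V" "k = f \<otimes> v" using F k by (auto simp: image_iff)
    have "cj k ` V = cj f ` cj v ` V"
      using f F(2) Kc subgroup.subset[OF V(2)] by (subst cj_image_cj) auto
    then show ?thesis using f cj_image_self[OF V(2)] by auto
  qed
  then have "core K V = (\<Inter>k\<in>F. cj k ` V)"
    unfolding core_def
  proof (intro equalityI INT_greatest)
    show "(\<Inter>k\<in>K. cj k ` V) \<subseteq> cj k ` V" if "k \<in> F" for k
      using F(2) that by (intro INT_lower) auto
    show "(\<Inter>k\<in>F. cj k ` V) \<subseteq> cj k ` V" if "k \<in> K" for k
      using \<open>\<And>k. k \<in> K \<Longrightarrow> \<exists>f\<in>F. cj k ` V = cj f ` V\<close>[OF that] by (metis INT_lower)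
  qed
  then show ?thesis using that F by blast
qed

lemma core_openin:
  assumes K: "compactin T K" "K \<noteq> {}" and V: "openin T V" "subgroup V G"
  shows "openin T (core K V)"
proof -
  obtain F where F: "finite F" "F \<subseteq> K" "core K V = (\<Inter>k\<in>F. cj k ` V)"
    using core_finite[OF K(1) V] .
  have Fc: "F \<subseteq> carrier G" using F(2) compactin_carrier[OF K(1)] by auto
  show ?thesis
  proof (cases "F = {}")
    \<comment> \<open>An intersection over no set is \<open>UNIV\<close>; since the core also lies
      in the carrier, it is the whole space.\<close>
    case True
    then have "core K V = UNIV" using F by simp
    moreover obtain k where "k \<in> K" using K(2) by blast
    then have "core K V \<subseteq> carrier G"
      using compactin_carrier[OF K(1)] cj_image_subset[OF _ subgroup.subset[OF V(2)], of k]
      unfolding core_def by blast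
    ultimately have "core K V = topspace T" using topspace_eq by auto
    then show ?thesis by simp
  next
    case False
    then show ?thesis unfolding F(3) using F(1) Fc V(1)
      by (intro openin_Inter) (auto intro: openin_cj_image)
  qed
qed

lemma core_subgroup:
  assumes "K \<subseteq> carrier G" "K \<noteq> {}" "subgroup V G"
  shows "subgroup (core K V) G"
  unfolding core_def using assms by (intro subgroups_Inter) (auto intro: cj_image_subgroup)

lemma core_subset: "\<one> \<in> K \<Longrightarrow> V \<subseteq> carrier G \<Longrightarrow> core K V \<subseteq> V"
  unfolding core_def using cj_image_one by blast

lemma core_normalised:
  assumes K: "subgroup K G" and V: "V \<subseteq> carrier G" and k: "k \<in> K"
  shows "cj k ` core K V = core K V"
proof (rule cj_image_normalised[OF K _ _ k])
  have Kc: "K \<subseteq> carrier G" by (rule subgroup.subset[OF K])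
  show cc: "core K V \<subseteq> carrier G"
    using core_subset[OF subgroup.one_closed[OF K] V] V by auto
  fix k assume k: "k \<in> K"
  show "cj k ` core K V \<subseteq> core K V"
  proof clarify
    fix x assume x: "x \<in> core K V"
    then have xc: "x \<in> carrier G" using cc by auto
    have "cj k x \<in> cj j ` V" if j: "j \<in> K" for j
    proof -
      have "inv k \<otimes> j \<in> K" using K k j by (simp add: subgroup.m_closed subgroup.m_inv_closed)
      then have "x \<in> cj (inv k \<otimes> j) ` V" using x by (auto simp: core_def)
      then have "cj k x \<in> cj k ` cj (inv k \<otimes> j) ` V" by blast
      also have "\<dots> = cj j ` V"
        using k j Kc V by (simp add: cj_image_cj subset_iff m_assoc[symmetric])
      finally show ?thesis .
    qed
    then show "cj k x \<in> core K V" by (auto simp: core_def)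
  qed
qed

end

lemma totally_disconnected_subtopology:
  assumes "totally_disconnected_space X"
  shows "totally_disconnected_space (subtopology X S)"
  unfolding totally_disconnected_space_def
proof
  fix C assume C: "C \<in> connected_components_of (subtopology X S)"
  then have conn: "connectedin X C"
    using connectedin_connected_components_of connectedin_subtopology by blast
  obtain x where x: "x \<in> C" using C nonempty_connected_components_of by blast
  then have "x \<in> topspace X" using connectedin_subset_topspace[OF conn] by blast
  then obtain y where "connected_component_of_set X x = {y}"
    using assms unfolding totally_disconnected_space_def connected_components_of_def by blast
  moreover have "C \<subseteq> connected_component_of_set X x"
    by (rule connected_component_of_maximal[OF conn x])
  ultimately show "\<exists>x. C = {x}" using x by (metis subset_singletonD empty_iff)
qed

text \<open>A word has finitely many letters; this replaces the union of all conjugates of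
  \<open>L\<close> by a finite set of generators.\<close>

lemma (in group) generate_finite_support:
  assumes "x \<in> generate G C"
  shows "\<exists>A. finite A \<and> A \<subseteq> C \<and> x \<in> generate G A"
  using assms
proof induction
  case one
  show ?case by (intro exI[of _ "{}"]) (auto intro: generate.one)
next
  case (incl h)
  then show ?case by (intro exI[of _ "{h}"]) (auto intro: generate.incl)
next
  case (inv h)
  then show ?case by (intro exI[of _ "{h}"]) (auto intro: generate.inv)
next
  case (eng h1 h2)
  then obtain A1 A2 where "finite A1" "A1 \<subseteq> C" "h1 \<in> generate G A1"
    "finite A2" "A2 \<subseteq> C" "h2 \<in> generate G A2" by auto
  moreover have "generate G A1 \<subseteq> generate G (A1 \<union> A2)" "generate G A2 \<subseteq> generate G (A1 \<union> A2)"
    by (auto intro!: mono_generate)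
  ultimately show ?case by (intro exI[of _ "A1 \<union> A2"]) (auto intro: generate.eng)
qed

section \<open>Closures of normal subgroups and stabilisers of compact open sets\<close>

context topological_group
begin

lemma closure_of_subgroup:
  assumes N: "subgroup N G"
  shows "subgroup (T closure_of N) G"
proof (rule subgroupI)
  have Nc: "N \<subseteq> topspace T" using subgroup.subset[OF N] topspace_eq by simp
  show cc: "T closure_of N \<subseteq> carrier G" using closure_of_subset_topspace topspace_eq by metis
  show "T closure_of N \<noteq> {}" using closure_of_subset[OF Nc] subgroup.one_closed[OF N] by blast
  show "inv a \<in> T closure_of N" if "a \<in> T closure_of N" for a
  proof -
    have "m_inv G ` (T closure_of N) \<subseteq> T closure_of (m_inv G ` N)"
      by (rule continuous_map_image_closure_subset[OF continuous_inv])
    also have "\<dots> \<subseteq> T closure_of N"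
      using subgroup.m_inv_closed[OF N] by (intro closure_of_mono) auto
    finally show ?thesis using that by blast
  qed
  show "a \<otimes> b \<in> T closure_of N" if "a \<in> T closure_of N" "b \<in> T closure_of N" for a b
  proof -
    have "(\<lambda>(x, y). x \<otimes> y) ` (prod_topology T T closure_of (N \<times> N)) \<subseteq> T closure_of ((\<lambda>(x, y). x \<otimes> y) ` (N \<times> N))"
      by (rule continuous_map_image_closure_subset[OF continuous_mult])
    also have "\<dots> \<subseteq> T closure_of N"
      using subgroup.m_closed[OF N] by (intro closure_of_mono) auto
    finally show ?thesis using that by (auto simp: closure_of_Times)
  qed
qed

lemma closure_of_normal:
  assumes N: "N \<lhd> G"
  shows "T closure_of N \<lhd> G"
  unfolding normal_inv_iff
proof (intro conjI ballI)
  show "subgroup (T closure_of N) G" by (rule closure_of_subgroup[OF normal_imp_subgroup[OF N]])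
  fix g h assume g: "g \<in> carrier G" and h: "h \<in> T closure_of N"
  have "cj g ` (T closure_of N) \<subseteq> T closure_of (cj g ` N)"
    by (rule continuous_map_image_closure_subset[OF continuous_map_cj[OF g]])
  also have "\<dots> \<subseteq> T closure_of N"
    using N g unfolding normal_inv_iff by (intro closure_of_mono) (auto simp: conjugation_def)
  finally show "g \<otimes> h \<otimes> inv g \<in> T closure_of N" using h by (auto simp: conjugation_def)
qed

text \<open>Tube lemma: the preimage of \<open>B\<close> under multiplication is open and contains
  the slice over the identity, and compactness of that slice leaves room for a whole neighbourhood
  of the identity.\<close>

lemma openin_stabiliser_neighbourhood:
  assumes B: "openin T B" "compactin T B"
  shows "\<exists>A. openin T A \<and> \<one> \<in> A \<and> (\<forall>a\<in>A. \<forall>b\<in>B. a \<otimes> b \<in> B)"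
proof (cases "B = {}")
  case True
  then show ?thesis using openin_topspace[of T] unfolding topspace_eq by auto
next
  case False
  have Bc: "B \<subseteq> carrier G" by (rule openin_carrier[OF B(1)])
  define P where "P = {p \<in> topspace (prod_topology T T). (\<lambda>(x, y). x \<otimes> y) p \<in> B}"
  have "openin (prod_topology T T) P"
    unfolding P_def by (rule openin_continuous_map_preimage[OF continuous_mult B(1)])
  moreover have "(\<one>, b) \<in> P" if "b \<in> B" for b
    using that Bc by (auto simp: P_def topspace_eq)
  ultimately have "\<exists>X Y. openin T X \<and> openin T Y \<and> \<one> \<in> X \<and> b \<in> Y \<and> X \<times> Y \<subseteq> P" if "b \<in> B" for b
    using that unfolding openin_prod_topology_alt by blast
  then obtain X Y where XY: "\<And>b. b \<in> B \<Longrightarrow>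
      openin T (X b) \<and> openin T (Y b) \<and> \<one> \<in> X b \<and> b \<in> Y b \<and> X b \<times> Y b \<subseteq> P"
    by metis
  have "B \<subseteq> \<Union>(Y ` B)" using XY by blast
  then obtain \<F> where \<F>: "finite \<F>" "\<F> \<subseteq> Y ` B" "B \<subseteq> \<Union>\<F>"
    using compactinD[OF B(2), of "Y ` B"] XY by blast
  then obtain F where F: "F \<subseteq> B" "finite F" "\<F> = Y ` F"
    by (meson finite_subset_image)
  have "F \<noteq> {}" using \<F> F False by auto
  have "a \<otimes> b \<in> B" if a: "a \<in> \<Inter>(X ` F)" and "b \<in> B" for a b
  proof -
    obtain f where f: "f \<in> F" "b \<in> Y f" using \<open>b \<in> B\<close> \<F> F by blast
    then have "(a, b) \<in> P" using a F XY[of f] by blast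
    then show "a \<otimes> b \<in> B" by (simp add: P_def)
  qed
  moreover have "openin T (\<Inter>(X ` F))" using \<open>F \<noteq> {}\<close> F XY by (intro openin_Inter) auto
  moreover have "\<one> \<in> \<Inter>(X ` F)" using F XY by auto
  ultimately show ?thesis by (intro exI[of _ "\<Inter>(X ` F)"]) blast
qed

lemma openin_inv_preimage: "openin T A \<Longrightarrow> openin T {x \<in> carrier G. inv x \<in> A}"
  using openin_continuous_map_preimage[OF continuous_inv] topspace_eq by metis

text \<open>The stabiliser lies in \<open>B\<close> since it moves the identity into
  \<open>B\<close>. It is open since it contains every element that lies, together with its inverse,
  in the neighbourhood given by the tube lemma.\<close>

lemma stabiliser_of_compact_open:
  assumes B: "openin T B" "compactin T B" "\<one> \<in> B"
  defines "V \<equiv> {g \<in> carrier G. (\<otimes>) g ` B = B}"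
  shows "subgroup V G" "openin T V" "V \<subseteq> B"
proof -
  have Bc: "B \<subseteq> carrier G" by (rule openin_carrier[OF B(1)])
  have mult: "(\<otimes>) a ` (\<otimes>) b ` B = (\<otimes>) (a \<otimes> b) ` B" if "a \<in> carrier G" "b \<in> carrier G" for a b
    unfolding image_image using that Bc by (intro image_cong) (auto simp: m_assoc)
  have one: "(\<otimes>) \<one> ` B = B" using Bc by (force simp: image_iff)
  show V: "subgroup V G"
  proof (rule subgroupI)
    show "V \<noteq> {}" using one unfolding V_def by blast
    show "inv a \<in> V" if "a \<in> V" for a
      using that mult[of "inv a" a] one by (auto simp: V_def)
    show "a \<otimes> b \<in> V" if "a \<in> V" "b \<in> V" for a b
      using that mult[of a b] by (auto simp: V_def)
  qed (auto simp: V_def)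
  show "V \<subseteq> B" using B(3) by (force simp: V_def)
  obtain A where A: "openin T A" "\<one> \<in> A" "\<And>a b. a \<in> A \<Longrightarrow> b \<in> B \<Longrightarrow> a \<otimes> b \<in> B"
    using openin_stabiliser_neighbourhood[OF B(1,2)] by auto
  have "A \<inter> {x \<in> carrier G. inv x \<in> A} \<subseteq> V"
  proof
    fix a assume a: "a \<in> A \<inter> {x \<in> carrier G. inv x \<in> A}"
    have "b \<in> (\<otimes>) a ` B" if "b \<in> B" for b
      using a A(3)[of "inv a" b] that Bc by (subst mem_translate) auto
    then show "a \<in> V" using a A(3) by (auto simp: V_def)
  qed
  then show "openin T V"
    using A(1,2) openin_inv_preimage[OF A(1)] by (intro openin_subgroupI[OF V, of "A \<inter> {x \<in> carrier G. inv x \<in> A}"]) auto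
qed

lemma discrete_if_openin_one:
  assumes "openin T {\<one>}"
  shows "T = discrete_topology (carrier G)"
proof -
  have "openin T {g}" if "g \<in> carrier G" for g
    using openin_translate[OF that assms] that by simp
  then show ?thesis
    using topspace_eq by (subst eq_commute, subst discrete_topology_unique) auto
qed

lemma closedin_compact_subset: "compactin T K \<Longrightarrow> closedin T C \<Longrightarrow> C \<subseteq> K \<Longrightarrow> compactin T C"
  using closed_compactin by metis

end

section \<open>Compact subgroups and van Dantzig's theorem\<close>

context tdlc_group
begin

lemma compact_subgroup_profinite:
  assumes K: "subgroup K G" "compactin T K"
  shows "profinite_group (G\<lparr>carrier := K\<rparr>) (subtopology T K)"
proof -
  interpret K: group "G\<lparr>carrier := K\<rparr>" by (rule subgroup_imp_group[OF K(1)])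
  have Kc: "K \<subseteq> topspace T" using subgroup.subset[OF K(1)] topspace_eq by simp
  show ?thesis
  proof
    show "topspace (subtopology T K) = carrier (G\<lparr>carrier := K\<rparr>)" using Kc by auto
    have "continuous_map (subtopology (prod_topology T T) (K \<times> K)) (subtopology T K) (\<lambda>(x, y). x \<otimes> y)"
      using subgroup.m_closed[OF K(1)] continuous_mult
      by (auto simp: continuous_map_in_subtopology intro: continuous_map_from_subtopology)
    then show "continuous_map (prod_topology (subtopology T K) (subtopology T K)) (subtopology T K)
        (\<lambda>(x, y). x \<otimes>\<^bsub>G\<lparr>carrier := K\<rparr>\<^esub> y)"
      by (simp add: subtopology_Times)
    have "continuous_map (subtopology T K) (subtopology T K) (m_inv G)"
      using subgroup.m_inv_closed[OF K(1)] continuous_inv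
      by (auto simp: continuous_map_in_subtopology intro: continuous_map_from_subtopology)
    then show "continuous_map (subtopology T K) (subtopology T K) (m_inv (G\<lparr>carrier := K\<rparr>))"
      by (rule continuous_map_eq) (use K(1) in \<open>auto simp: m_inv_consistent\<close>)
    show "Hausdorff_space (subtopology T K)" using Hausdorff by (rule Hausdorff_space_subtopology)
    show "compact_space (subtopology T K)" using K(2) by (rule compact_space_subtopology)
    show "totally_disconnected_space (subtopology T K)"
      using totally_disconnected by (rule totally_disconnected_subtopology)
  qed
qed

text \<open>In a compact Hausdorff space components and quasi-components agree, so a clopen set
  separates the identity from any closed set missing it.\<close>

lemma ex_compact_open_neighbourhood:
  assumes x: "x \<in> carrier G" "x \<noteq> \<one>"
  obtains B where "openin T B" "compactin T B" "\<one> \<in> B" "x \<notin> B"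
proof -
  have "\<one> \<in> topspace T" using topspace_eq by simp
  then obtain O' K where OK: "openin T O'" "compactin T K" "\<one> \<in> O'" "O' \<subseteq> K"
    using locally_compact unfolding locally_compact_space_def by blast
  define X where "X = subtopology T K"
  have tX: "topspace X = K" unfolding X_def using compactin_subset_topspace[OF OK(2)] by auto
  have cX: "compact_space X" unfolding X_def using OK(2) by (rule compact_space_subtopology)
  have hX: "Hausdorff_space X" unfolding X_def using Hausdorff by (rule Hausdorff_space_subtopology)
  have one: "\<one> \<in> topspace X" using OK tX by auto
  have "connected_component_of_set X \<one> \<in> connected_components_of X"
    using one by (simp add: connected_component_in_connected_components_of)
  moreover have "totally_disconnected_space X"
    unfolding X_def using totally_disconnected by (rule totally_disconnected_subtopology)
  ultimately obtain y where y: "connected_component_of_set X \<one> = {y}"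
    unfolding totally_disconnected_space_def by blast
  moreover have "\<one> \<in> connected_component_of_set X \<one>"
    using one by (simp add: connected_component_of_refl)
  ultimately have "{\<one>} \<in> connected_components_of X"
    using \<open>connected_component_of_set X \<one> \<in> connected_components_of X\<close> by auto
  then have q: "{\<one>} \<in> quasi_components_of X"
    using quasi_eq_connected_components_of[of X] cX hX by simp
  have "openin T (O' - {x})"
    using OK(1) closedin_Hausdorff_singleton[OF Hausdorff, of x] x(1) topspace_eq by (simp add: openin_diff)
  then have "openin X (K \<inter> (O' - {x}))" unfolding X_def by (simp add: openin_subtopology_Int2)
  then have "closedin X (topspace X - (K \<inter> (O' - {x})))" by blast
  then have "compactin X (topspace X - (K \<inter> (O' - {x})))"
    using cX closedin_compact_space by blast
  \<comment> \<open>Besides \<open>x\<close>, the part of \<open>K\<close> outside \<open>O'\<close>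
    is split off: a set open in \<open>K\<close> is known to be open in \<open>T\<close> once it
    lies inside the open set \<open>O'\<close>.\<close>
  then have "separated_between X {\<one>} (topspace X - (K \<inter> (O' - {x})))"
    using separated_between_quasi_component_compact[OF q] OK(3,4) x(2) by (auto simp: disjnt_iff)
  then obtain A B where AB: "openin X A" "openin X B" "A \<union> B = topspace X" "disjnt A B" "\<one> \<in> A"
      "topspace X - (K \<inter> (O' - {x})) \<subseteq> B"
    unfolding separated_between_def by auto
  have sub: "A \<subseteq> O' - {x}" using AB tX unfolding disjnt_def by blast
  obtain A' where A': "openin T A'" "A = A' \<inter> K" using AB(1) unfolding X_def openin_subtopology by auto
  have "A = A' \<inter> O'" using A' sub OK(4) by blast
  then have "openin T A" using A' OK(1) by auto
  moreover have "A = topspace X - B" using AB unfolding disjnt_def by blast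
  then have "closedin X A" using AB(2) by blast
  then have "compactin X A" using cX closedin_compact_space by blast
  then have "compactin T A" unfolding X_def by (simp add: compactin_subtopology)
  ultimately show ?thesis using that AB(5) sub by blast
qed

text \<open>Leaving out a prescribed \<open>x\<close> is the form in which small subgroups are used:
  they separate points from the identity.\<close>

lemma ex_compact_open_subgroup:
  assumes "x \<in> carrier G" "x \<noteq> \<one>"
  obtains V where "subgroup V G" "openin T V" "compactin T V" "x \<notin> V"
proof -
  obtain B where B: "openin T B" "compactin T B" "\<one> \<in> B" "x \<notin> B"
    using ex_compact_open_neighbourhood[OF assms] .
  note V = stabiliser_of_compact_open[OF B(1-3)]
  show ?thesis
    using that[OF V(1,2)] closedin_compact_subset[OF B(2) closedin_open_subgroup[OF V(1,2)] V(3)] V(3) B(4) by blast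
qed

end

section \<open>Normal subgroups and generation in the class S\<close>

context class_S
begin

text \<open>In a compact group the core of an open subgroup under the whole group is open and
  normal. By simplicity it is trivial, against non-discreteness, or everything, against the point
  left out of \<open>V\<close>.\<close>

lemma not_compact: "\<not> compactin T (carrier G)"
proof
  assume comp: "compactin T (carrier G)"
  obtain x where x: "x \<in> carrier G" "x \<noteq> \<one>"
    using topologically_simple one_closed unfolding topologically_simple_def by blast
  obtain V where V: "subgroup V G" "openin T V" "compactin T V" "x \<notin> V"
    using ex_compact_open_subgroup[OF x] .
  have Vc: "V \<subseteq> carrier G" by (rule subgroup.subset[OF V(1)])
  define N where "N = core (carrier G) V"
  have N: "subgroup N G" "openin T N"
    unfolding N_def using comp V carrier_not_empty by (auto intro: core_subgroup core_openin)
  have "N \<lhd> G"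
    using N(1) core_normalised[OF subgroup_self Vc] unfolding normal_inv_iff N_def[symmetric]
    by (auto simp: conjugation_def)
  then have "N = {\<one>} \<or> N = carrier G"
    using topologically_simple closedin_open_subgroup[OF N] unfolding topologically_simple_def by blast
  moreover have "N \<subseteq> V" unfolding N_def by (rule core_subset[OF one_closed Vc])
  ultimately show False
    using discrete_if_openin_one non_discrete N(2) x V(4) by auto
qed

lemma compact_normal_trivial:
  assumes "compactin T N" "N \<lhd> G"
  shows "N = {\<one>}"
  using assms topologically_simple not_compact compactin_imp_closedin[OF Hausdorff]
  unfolding topologically_simple_def by blast

text \<open>Simplicity makes the normal closure of \<open>L\<close> dense, so it meets each of the
  finitely many cosets of \<open>U\<close> that cover a compact generating set. Each meeting point
  is a word in finitely many conjugates of elements of \<open>L\<close>.\<close>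

lemma generated_by_open_subgroup_and_conjugates:
  assumes L: "subgroup L G" "L \<noteq> {\<one>}" and U: "subgroup U G" "openin T U"
  obtains A where "finite A" "A \<subseteq> (\<Union>g\<in>carrier G. cj g ` L)" "generate G (U \<union> A) = carrier G"
proof -
  define C where "C = (\<Union>g\<in>carrier G. cj g ` L)"
  have Lc: "L \<subseteq> carrier G" by (rule subgroup.subset[OF L(1)])
  have Cc: "C \<subseteq> carrier G" using Lc unfolding C_def by auto
  have "g \<otimes> h \<otimes> inv g \<in> C" if h: "h \<in> C" and g: "g \<in> carrier G" for g h
  proof -
    obtain k l where k: "k \<in> carrier G" "l \<in> L" "h = cj k l" using h unfolding C_def by auto
    have "cj g h = cj (g \<otimes> k) l" using k g Lc by (auto simp: cj_cj)
    then have "cj g h \<in> C" using k g unfolding C_def by blast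
    then show ?thesis by (simp add: conjugation_def)
  qed
  then have N: "generate G C \<lhd> G" by (intro normal_generateI[OF Cc])
  have "L \<subseteq> C" using cj_image_one[OF Lc] unfolding C_def by blast
  then have LN: "L \<subseteq> generate G C" by (auto intro: generate.incl)
  have Nc: "generate G C \<subseteq> topspace T" using generate_incl[OF Cc] topspace_eq by simp
  have "T closure_of (generate G C) = {\<one>} \<or> T closure_of (generate G C) = carrier G"
    using topologically_simple closure_of_normal[OF N] closedin_closure_of
    unfolding topologically_simple_def by blast
  moreover have "T closure_of (generate G C) \<noteq> {\<one>}"
    using LN closure_of_subset[OF Nc] L(2) subgroup.one_closed[OF L(1)] by blast
  ultimately have dense: "T closure_of (generate G C) = carrier G" by blast
  obtain K where K: "compactin T K" "generate G K = carrier G"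
    using compactly_generated unfolding compactly_generated_def by blast
  obtain F where F: "finite F" "F \<subseteq> K" "K \<subseteq> (\<Union>f\<in>F. (\<otimes>) f ` U)"
    using compactin_open_cosets[OF K(1) U(2) subgroup.one_closed[OF U(1)]] .
  have Fc: "F \<subseteq> carrier G" using F(2) compactin_carrier[OF K(1)] by blast
  have "\<exists>A. finite A \<and> A \<subseteq> C \<and> (\<exists>u\<in>U. f \<otimes> u \<in> generate G A)" if f: "f \<in> F" for f
  proof -
    have fc: "f \<in> carrier G" using f Fc by blast
    have "openin T ((\<otimes>) f ` U)" by (rule openin_translate[OF fc U(2)])
    moreover have "f \<in> (\<otimes>) f ` U" using subgroup.one_closed[OF U(1)] fc by force
    moreover have "f \<in> T closure_of (generate G C)" using dense fc by simp
    ultimately obtain n where n: "n \<in> generate G C" "n \<in> (\<otimes>) f ` U"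
      unfolding in_closure_of by blast
    obtain B where "finite B" "B \<subseteq> C" "n \<in> generate G B"
      using generate_finite_support[OF n(1)] by auto
    moreover obtain u where "u \<in> U" "n = f \<otimes> u" using n(2) by auto
    ultimately show ?thesis by auto
  qed
  then obtain A where A: "\<And>f. f \<in> F \<Longrightarrow> finite (A f) \<and> A f \<subseteq> C \<and> (\<exists>u\<in>U. f \<otimes> u \<in> generate G (A f))"
    by metis
  define B where "B = (\<Union>f\<in>F. A f)"
  have Bc: "U \<union> B \<subseteq> carrier G" using A Cc subgroup.subset[OF U(1)] unfolding B_def by blast
  define H where "H = generate G (U \<union> B)"
  have H: "subgroup H G" unfolding H_def by (rule generate_is_subgroup[OF Bc])
  have UH: "U \<subseteq> H" unfolding H_def by (auto intro: generate.incl)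
  have "f \<otimes> u \<in> H" if f: "f \<in> F" and u: "u \<in> U" for f u
  proof -
    obtain v where v: "v \<in> U" "f \<otimes> v \<in> generate G (A f)" using A[OF f] by blast
    have "generate G (A f) \<subseteq> H" unfolding H_def B_def using f by (intro mono_generate) auto
    then have "f \<otimes> v \<in> H" using v by blast
    moreover have "inv v \<otimes> u \<in> H"
      using u v UH H by (simp add: subgroup.m_closed subgroup.m_inv_closed subset_iff)
    ultimately have "(f \<otimes> v) \<otimes> (inv v \<otimes> u) \<in> H" by (rule subgroup.m_closed[OF H])
    moreover have "(f \<otimes> v) \<otimes> (inv v \<otimes> u) = f \<otimes> u"
    proof -
      have c: "f \<in> carrier G" "v \<in> carrier G" "u \<in> carrier G"
        using f Fc v u subgroup.subset[OF U(1)] by auto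
      then have "v \<otimes> (inv v \<otimes> u) = u" by (simp add: m_assoc[symmetric])
      then show ?thesis using c by (simp add: m_assoc)
    qed
    ultimately show ?thesis by simp
  qed
  then have "K \<subseteq> H" using F(3) by auto
  then have "generate G K \<subseteq> H" by (rule generate_subgroup_incl[OF _ H])
  then have "generate G (U \<union> B) = carrier G"
    using K(2) subgroup.subset[OF H] unfolding H_def by blast
  moreover have "finite B" "B \<subseteq> C" using A F(1) unfolding B_def by auto
  ultimately show ?thesis using that unfolding C_def by blast
qed

lemma normalI_generators:
  assumes gen: "generate G (U \<union> A) = carrier G" and N: "subgroup N G"
    and U: "U \<subseteq> carrier G" "\<And>u. u \<in> U \<Longrightarrow> cj u ` N = N"
    and A: "A \<subseteq> carrier G" "\<And>a. a \<in> A \<Longrightarrow> cj a ` N = N"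
  shows "N \<lhd> G"
proof -
  have "U \<union> A \<subseteq> {g \<in> carrier G. cj g ` N = N}"
    using U A by (intro subsetI CollectI conjI) (metis Un_iff subsetD)+
  then have "carrier G \<subseteq> {g \<in> carrier G. cj g ` N = N}"
    using generate_subgroup_incl[OF _ normaliser_subgroup[OF subgroup.subset[OF N]]] gen by blast
  then show ?thesis using N unfolding normal_inv_iff by (auto simp: conjugation_def)
qed

text \<open>If \<open>L \<inter> U\<close> were trivial, the conjugates of elements of \<open>L\<close> would have open centralisers,
  and \<open>G\<close> would have a compact open normal subgroup centralised by finitely many of them.\<close>

lemma locally_normal_Int_open:
  assumes L: "locally_normal G T L" "L \<noteq> {\<one>}"
    and U: "subgroup U G" "openin T U" "compactin T U"
  shows "L \<inter> U \<noteq> {\<one>}"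
proof
  assume triv: "L \<inter> U = {\<one>}"
  have Ls: "subgroup L G" using L(1) unfolding locally_normal_def by simp
  have Lc: "L \<subseteq> carrier G" by (rule subgroup.subset[OF Ls])
  have Uc: "U \<subseteq> carrier G" by (rule subgroup.subset[OF U(1)])
  define M where "M = {g \<in> carrier G. cj g ` L = L}"
  have M: "subgroup M G" "openin T M"
    using normaliser_subgroup[OF Lc] normalizer_eq[OF Lc] L(1) unfolding M_def locally_normal_def by auto
  obtain A where A: "finite A" "A \<subseteq> (\<Union>g\<in>carrier G. cj g ` L)" "generate G (U \<union> A) = carrier G"
    using generated_by_open_subgroup_and_conjugates[OF Ls L(2) U(1,2)] .
  have Ac: "A \<subseteq> carrier G" using A(2) cj_image_subset[OF _ Lc] by blast
  \<comment> \<open>The commutator of \<open>v\<close> and \<open>l\<close> lies in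
    \<open>L\<close>, as \<open>v\<close> normalises \<open>L\<close>, and in \<open>U\<close>, as
    both \<open>v\<close> and its conjugate by \<open>l\<close> do. By assumption it is
    trivial.\<close>
  have l: "cj v l = l" if l: "l \<in> L" and v: "v \<in> M" "v \<in> U" "cj l v \<in> U" for l v
  proof -
    have c: "v \<in> carrier G" "l \<in> carrier G" using v l Uc Lc by auto
    have "cj v l \<in> L" using v(1) l unfolding M_def by blast
    then have "cj v l \<otimes> inv l \<in> L" using l Ls by (simp add: subgroup.m_closed subgroup.m_inv_closed)
    moreover have "cj v l \<otimes> inv l = v \<otimes> inv (cj l v)"
      using c by (simp add: conjugation_def inv_mult_group m_assoc)
    moreover have "v \<otimes> inv (cj l v) \<in> U"
      using v U(1) by (simp add: subgroup.m_closed subgroup.m_inv_closed)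
    ultimately have "cj v l \<otimes> inv l = \<one>" using triv by auto
    then show ?thesis using c inv_equality[of "cj v l" "inv l"] by simp
  qed
  have "\<exists>V. subgroup V G \<and> openin T V \<and> (\<forall>v\<in>V. cj a v = v)" if a: "a \<in> A" for a
  proof -
    obtain g l where g: "g \<in> carrier G" "l \<in> L" "a = cj g l" using a A(2) by blast
    have lc: "l \<in> carrier G" using g Lc by auto
    \<comment> \<open>The last factor says that the conjugate of \<open>v\<close> by
      \<open>l\<close> stays in \<open>U\<close>, which the commutator step asks for.\<close>
    define V where "V = M \<inter> U \<inter> cj (inv l) ` U"
    have V: "subgroup V G" "openin T V" unfolding V_def using M U lc
      by (auto intro!: subgroups_Inter_pair cj_image_subgroup openin_cj_image)
    have "cj a (cj g v) = cj g v" if v: "v \<in> V" for v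
    proof -
      have vc: "v \<in> carrier G" using v Uc unfolding V_def by auto
      have "cj l v \<in> U" using v lc Uc vc mem_cj_image[of "inv l" U v] unfolding V_def by auto
      then have "cj v l = l" using l g v unfolding V_def by auto
      then have "v \<otimes> l = l \<otimes> v"
        using vc lc inv_solve_right[of l "v \<otimes> l" v] by (auto simp: conjugation_def)
      then have "cj l v = v" using vc lc by (simp add: conjugation_def m_assoc flip: \<open>v \<otimes> l = l \<otimes> v\<close>)
      moreover have "cj a (cj g v) = cj g (cj l v)"
        using g lc vc group_hom.hom_mult[OF cj_hom[OF g(1)]] group_hom.hom_inv[OF cj_hom[OF g(1)]]
        by (simp add: conjugation_def[of G "cj g l"] conjugation_def[of G l])
      ultimately show ?thesis by simp
    qed
    then have "\<forall>v\<in>cj g ` V. cj a v = v" by blast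
    then show ?thesis using cj_image_subgroup[OF g(1) V(1)] openin_cj_image[OF g(1) V(2)] by blast
  qed
  then obtain V where V: "\<And>a. a \<in> A \<Longrightarrow> subgroup (V a) G \<and> openin T (V a) \<and> (\<forall>v\<in>V a. cj a v = v)"
    by metis
  define V' where "V' = \<Inter>(insert U (V ` A))"
  have V': "subgroup V' G" unfolding V'_def by (rule subgroups_Inter) (use V U in auto)
  have V'o: "openin T V'" unfolding V'_def by (rule openin_Inter) (use V U A(1) in auto)
  define W where "W = core U V'"
  have W: "subgroup W G" "openin T W"
    unfolding W_def using V' V'o U Uc subgroup.one_closed[OF U(1)] by (auto intro!: core_subgroup core_openin)
  have WV: "W \<subseteq> V'"
    unfolding W_def using core_subset[OF subgroup.one_closed[OF U(1)] subgroup.subset[OF V']] .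
  \<comment> \<open>\<open>U\<close> normalises \<open>W\<close> because it is a core under
    \<open>U\<close>, and every element of \<open>A\<close> centralises it. An open compact normal
    subgroup contradicts non-discreteness.\<close>
  have "W \<lhd> G"
  proof (rule normalI_generators[OF A(3) W(1) Uc _ Ac])
    show "cj u ` W = W" if "u \<in> U" for u
      unfolding W_def by (rule core_normalised[OF U(1) subgroup.subset[OF V'] that])
    show "cj a ` W = W" if "a \<in> A" for a
      using V[OF that] WV that unfolding V'_def by force
  qed
  moreover have "compactin T W"
    using closedin_compact_subset[OF U(3) closedin_open_subgroup[OF W]] WV unfolding V'_def by auto
  ultimately have "W = {\<one>}" by (rule compact_normal_trivial[rotated])
  then show False using discrete_if_openin_one non_discrete W(2) by auto
qed

end

section \<open>Residuals\<close>

text \<open>\<open>Q X N\<close> plays the role of ``\<open>X / (X \<inter> N)\<close> belongs to a fixed class of groups closed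
  under subgroups, quotients and extensions''.\<close>

locale section_class = group G for G (structure) +
  fixes Q :: "'a set \<Rightarrow> 'a set \<Rightarrow> bool"
  assumes Q_refl: "X \<subseteq> carrier G \<Longrightarrow> Q X X"
    and Q_sub: "Q X N \<Longrightarrow> Y \<subseteq> X \<Longrightarrow> Q Y N"
    and Q_super: "Q X N \<Longrightarrow> N \<subseteq> N' \<Longrightarrow> Q X N'"
    and Q_trans: "X \<subseteq> carrier G \<Longrightarrow> Q X Y \<Longrightarrow> Q Y N \<Longrightarrow> Q X N"
    and Q_inter: "subgroup X G \<Longrightarrow> Q X N \<Longrightarrow> Q X (X \<inter> N)"
    and Q_mult: "subgroup X G \<Longrightarrow> K \<lhd> G\<lparr>carrier := X\<rparr> \<Longrightarrow> subgroup Y G \<Longrightarrow> Y \<subseteq> X \<Longrightarrow>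
          X \<subseteq> K <#> Y \<Longrightarrow> Q Y K \<Longrightarrow> Q X K"
    and Q_cj: "g \<in> carrier G \<Longrightarrow> X \<subseteq> carrier G \<Longrightarrow> Q X N \<Longrightarrow> Q (cj g ` X) (cj g ` N)"

locale topological_section_class = topological_group G T + section_class G Q
  for G (structure) and T and Q
begin

definition quotient_kernels :: "'a set \<Rightarrow> 'a set set" where
  "quotient_kernels X = {N. subgroup N G \<and> N \<subseteq> X \<and> (\<forall>x\<in>X. cj x ` N = N) \<and> openin T N \<and> Q X N}"

text \<open>For a compact open subgroup \<open>X\<close> this is the smallest closed normal subgroup
  whose quotient is pro-(the class). An open \<open>X\<close> belongs to its own family of kernels,
  so the intersection does not degenerate to \<open>UNIV\<close>.\<close>

definition residual :: "'a set \<Rightarrow> 'a set" where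
  "residual X = \<Inter>(quotient_kernels X)"

lemma self_in_quotient_kernels:
  assumes "subgroup X G" "openin T X"
  shows "X \<in> quotient_kernels X"
  using assms by (simp add: quotient_kernels_def cj_image_self Q_refl subgroup.subset)

lemma residual_subset: "subgroup X G \<Longrightarrow> openin T X \<Longrightarrow> residual X \<subseteq> X"
  unfolding residual_def using self_in_quotient_kernels by blast

lemma residual_subgroup: "subgroup X G \<Longrightarrow> openin T X \<Longrightarrow> subgroup (residual X) G"
  unfolding residual_def
proof (rule subgroups_Inter)
  assume "subgroup X G" "openin T X"
  then show "quotient_kernels X \<noteq> {}" using self_in_quotient_kernels by blast
qed (auto simp: quotient_kernels_def)

lemma residual_closedin:
  assumes "subgroup X G" "openin T X"
  shows "closedin T (residual X)"
  unfolding residual_def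
proof (rule closedin_Inter)
  show "quotient_kernels X \<noteq> {}" using self_in_quotient_kernels[OF assms] by blast
qed (auto simp: quotient_kernels_def intro: closedin_open_subgroup)

text \<open>\<open>N\<close> modulo \<open>N \<inter> M\<close> embeds in \<open>X\<close> modulo
  \<open>M\<close>, so it is in the class; closure under extensions, applied to \<open>X\<close>
  modulo \<open>N\<close>, does the rest.\<close>

lemma quotient_kernels_Int:
  assumes X: "subgroup X G" and N: "N \<in> quotient_kernels X" "M \<in> quotient_kernels X"
  shows "N \<inter> M \<in> quotient_kernels X"
proof -
  have s: "subgroup N G" "N \<subseteq> X" "subgroup M G" "Q X N" "Q X M" "openin T N" "openin T M"
    "\<And>x. x \<in> X \<Longrightarrow> cj x ` N = N" "\<And>x. x \<in> X \<Longrightarrow> cj x ` M = M"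
    using N unfolding quotient_kernels_def by auto
  have "Q N (N \<inter> M)" using Q_inter[OF s(1)] Q_sub[OF s(5,2)] by blast
  then have "Q X (N \<inter> M)" using Q_trans[OF subgroup.subset[OF X] s(4)] by blast
  moreover have NM: "subgroup (N \<inter> M) G" using s by (intro subgroups_Inter_pair)
  moreover have "cj x ` (N \<inter> M) = N \<inter> M" if "x \<in> X" for x
  proof (rule cj_image_normalised[OF X subgroup.subset[OF NM] _ that])
    fix k assume "k \<in> X"
    then show "cj k ` (N \<inter> M) \<subseteq> N \<inter> M" using s(8,9)[of k] by blast
  qed
  ultimately show ?thesis using s unfolding quotient_kernels_def by auto
qed

lemma quotient_kernels_Inter:
  assumes X: "subgroup X G" "openin T X" and F: "finite F" "F \<subseteq> quotient_kernels X"
  shows "\<Inter>(insert X F) \<in> quotient_kernels X"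
  using F
proof (induction F)
  case empty
  show ?case using self_in_quotient_kernels[OF X] by simp
next
  case (insert N F)
  have "\<Inter>(insert X (insert N F)) = N \<inter> \<Inter>(insert X F)" by auto
  then show ?case using quotient_kernels_Int[OF X(1)] insert by simp
qed

lemma cj_in_quotient_kernels:
  assumes g: "g \<in> carrier G" and X: "subgroup X G" and N: "N \<in> quotient_kernels X"
  shows "cj g ` N \<in> quotient_kernels (cj g ` X)"
proof -
  have s: "subgroup N G" "N \<subseteq> X" "Q X N" "openin T N" "\<And>x. x \<in> X \<Longrightarrow> cj x ` N = N"
    using N unfolding quotient_kernels_def by auto
  have "cj y ` cj g ` N = cj g ` N" if y: "y \<in> cj g ` X" for y
  proof -
    obtain x where x: "x \<in> X" "y = cj g x" using y by auto
    have c: "x \<in> carrier G" "N \<subseteq> carrier G" using x X s(1) subgroup.subset by auto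
    have "cj y ` cj g ` N = cj (y \<otimes> g) ` N" using x c g by (simp add: cj_image_cj)
    also have "y \<otimes> g = g \<otimes> x" using x c g by (simp add: conjugation_def m_assoc)
    also have "cj (g \<otimes> x) ` N = cj g ` cj x ` N" using c g by (simp add: cj_image_cj)
    finally show ?thesis using s(5)[OF x(1)] by simp
  qed
  then show ?thesis
    using s cj_image_subgroup[OF g s(1)] openin_cj_image[OF g s(4)]
      Q_cj[OF g subgroup.subset[OF X] s(3)]
    unfolding quotient_kernels_def by blast
qed

lemma cj_residual:
  assumes g: "g \<in> carrier G" and X: "subgroup X G" "openin T X"
  shows "cj g ` residual X = residual (cj g ` X)"
proof
  \<comment> \<open>One inclusion for all \<open>g\<close> and \<open>X\<close> suffices: the other
    is the same one for the inverse of \<open>g\<close> and the conjugate of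
    \<open>X\<close>.\<close>
  have sub: "residual (cj g ` X) \<subseteq> cj g ` residual X"
    if g: "g \<in> carrier G" and X: "subgroup X G" "openin T X" for g X
  proof
    fix y assume y: "y \<in> residual (cj g ` X)"
    have gX: "subgroup (cj g ` X) G" "openin T (cj g ` X)"
      using cj_image_subgroup[OF g X(1)] openin_cj_image[OF g X(2)] by auto
    have yc: "y \<in> carrier G" using y residual_subset[OF gX] subgroup.subset[OF gX(1)] by blast
    have "cj (inv g) y \<in> N" if N: "N \<in> quotient_kernels X" for N
    proof -
      have "y \<in> cj g ` N" using y cj_in_quotient_kernels[OF g X(1) N] unfolding residual_def by blast
      moreover have "N \<subseteq> carrier G" using N subgroup.subset unfolding quotient_kernels_def by blast
      ultimately show ?thesis using mem_cj_image[OF g _ yc] by blast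
    qed
    then have "cj (inv g) y \<in> residual X" unfolding residual_def by blast
    then show "y \<in> cj g ` residual X"
      using mem_cj_image[OF g _ yc] residual_subset[OF X] subgroup.subset[OF X(1)] by (metis order_trans)
  qed
  have gX: "subgroup (cj g ` X) G" "openin T (cj g ` X)"
    using cj_image_subgroup[OF g X(1)] openin_cj_image[OF g X(2)] by auto
  have "residual X \<subseteq> cj (inv g) ` residual (cj g ` X)"
    using sub[of "inv g" "cj g ` X"] g gX subgroup.subset[OF X(1)] by simp
  then have "cj g ` residual X \<subseteq> cj g ` cj (inv g) ` residual (cj g ` X)" by (rule image_mono)
  then show "cj g ` residual X \<subseteq> residual (cj g ` X)"
    using g residual_subset[OF gX] subgroup.subset[OF gX(1)] by simp
  show "residual (cj g ` X) \<subseteq> cj g ` residual X" by (rule sub[OF g X])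
qed

text \<open>Every kernel of \<open>W\<close> contains a kernel of \<open>X\<close>: its core under
  \<open>X\<close> is a finite intersection of \<open>X\<close>-conjugates, all of them kernels of
  the normal subgroup \<open>W\<close>, and closure under extensions lifts the core from
  \<open>W\<close> to \<open>X\<close>. Conversely, a kernel of \<open>X\<close> is cut down to
  \<open>W\<close>.\<close>

lemma residual_eq:
  assumes X: "subgroup X G" "openin T X" "compactin T X"
    and W: "subgroup W G" "openin T W" "W \<subseteq> X" "\<And>x. x \<in> X \<Longrightarrow> cj x ` W = W" "Q X W"
  shows "residual X = residual W"
proof
  have Xc: "X \<subseteq> carrier G" by (rule subgroup.subset[OF X(1)])
  have "\<exists>M\<in>quotient_kernels X. M \<subseteq> N" if N: "N \<in> quotient_kernels W" for N
  proof -
    have s: "subgroup N G" "N \<subseteq> W" "openin T N" using N unfolding quotient_kernels_def by auto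
    have Nc: "N \<subseteq> carrier G" by (rule subgroup.subset[OF s(1)])
    obtain F where F: "finite F" "F \<subseteq> X" "core X N = (\<Inter>k\<in>F. cj k ` N)"
      using core_finite[OF X(3) s(3,1)] .
    have sub: "core X N \<subseteq> N" by (rule core_subset[OF subgroup.one_closed[OF X(1)] Nc])
    have "(\<lambda>k. cj k ` N) ` F \<subseteq> quotient_kernels W"
    proof clarify
      fix k assume "k \<in> F"
      then have "k \<in> X" using F(2) by blast
      then show "cj k ` N \<in> quotient_kernels W"
        using cj_in_quotient_kernels[OF _ W(1) N, of k] W(4) Xc by auto
    qed
    then have "\<Inter>(insert W ((\<lambda>k. cj k ` N) ` F)) \<in> quotient_kernels W"
      using F(1) by (intro quotient_kernels_Inter[OF W(1,2)]) auto
    moreover have "\<Inter>(insert W ((\<lambda>k. cj k ` N) ` F)) = core X N"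
      using F(3) sub s(2) by auto
    ultimately have "Q W (core X N)" unfolding quotient_kernels_def by auto
    then have "Q X (core X N)" by (rule Q_trans[OF Xc W(5)])
    moreover have "subgroup (core X N) G" "openin T (core X N)"
      using X s Xc subgroup.one_closed[OF X(1)] by (auto intro!: core_subgroup core_openin)
    moreover have "\<forall>x\<in>X. cj x ` core X N = core X N" using core_normalised[OF X(1) Nc] by blast
    ultimately have "core X N \<in> quotient_kernels X"
      using sub s(2) W(3) unfolding quotient_kernels_def by blast
    then show ?thesis using sub by blast
  qed
  then show "residual X \<subseteq> residual W" unfolding residual_def by blast
  have "N \<inter> W \<in> quotient_kernels W" if N: "N \<in> quotient_kernels X" for N
  proof -
    have "W \<in> quotient_kernels X" using W unfolding quotient_kernels_def by blast
    then have "N \<inter> W \<in> quotient_kernels X" by (rule quotient_kernels_Int[OF X(1) N])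
    then show ?thesis using W(3) Q_sub unfolding quotient_kernels_def by blast
  qed
  then show "residual W \<subseteq> residual X" unfolding residual_def by blast
qed

text \<open>\<open>W - N\<close> is compact and covered by the complements of the kernels, so a
  finite intersection of kernels, itself a kernel, already lies in \<open>N\<close>.\<close>

lemma residual_trivial_imp:
  assumes W: "subgroup W G" "openin T W" "compactin T W" "residual W = {\<one>}"
    and N: "subgroup N G" "openin T N"
  shows "Q W N"
proof -
  have comp: "compactin T (W - N)"
    using closedin_diff[OF closedin_open_subgroup[OF W(1,2)] N(2)]
    by (intro closedin_compact_subset[OF W(3)]) auto
  have "W - N \<subseteq> \<Union>((\<lambda>M. topspace T - M) ` quotient_kernels W)"
  proof
    fix x assume x: "x \<in> W - N"
    then have "x \<noteq> \<one>" using subgroup.one_closed[OF N(1)] by auto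
    then obtain M where "M \<in> quotient_kernels W" "x \<notin> M"
      using W(4) unfolding residual_def by blast
    moreover have "x \<in> topspace T" using x subgroup.subset[OF W(1)] topspace_eq by auto
    ultimately show "x \<in> \<Union>((\<lambda>M. topspace T - M) ` quotient_kernels W)" by blast
  qed
  moreover have "openin T (topspace T - M)" if "M \<in> quotient_kernels W" for M
    using that closedin_open_subgroup unfolding quotient_kernels_def by blast
  ultimately obtain \<F> where \<F>: "finite \<F>" "\<F> \<subseteq> (\<lambda>M. topspace T - M) ` quotient_kernels W" "W - N \<subseteq> \<Union>\<F>"
    using compactinD[OF comp, of "(\<lambda>M. topspace T - M) ` quotient_kernels W"] by auto
  then obtain F where F: "F \<subseteq> quotient_kernels W" "finite F" "\<F> = (\<lambda>M. topspace T - M) ` F"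
    by (meson finite_subset_image)
  have "\<Inter>(insert W F) \<in> quotient_kernels W" by (rule quotient_kernels_Inter[OF W(1,2) F(2,1)])
  then have "Q W (\<Inter>(insert W F))" unfolding quotient_kernels_def by blast
  moreover have "\<Inter>(insert W F) \<subseteq> N" using \<F>(3) F(3) by blast
  ultimately show ?thesis by (rule Q_super)
qed

text \<open>The test groups are open subgroups of \<open>G\<close> normalised by \<open>L\<close>,
  instead of open normal subgroups of \<open>L\<close>: they can be conjugated in \<open>G\<close>,
  and cores under \<open>L\<close> supply them.\<close>

definition pro :: "'a set \<Rightarrow> bool" where
  "pro L \<longleftrightarrow> (\<forall>V. subgroup V G \<and> openin T V \<and> (\<forall>l\<in>L. cj l ` V = V) \<longrightarrow> Q L V)"

lemma pro_cj:
  assumes L: "pro L" "subgroup L G" and g: "g \<in> carrier G"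
  shows "pro (cj g ` L)"
  unfolding pro_def
proof (intro allI impI, elim conjE)
  fix V assume V: "subgroup V G" "openin T V" "\<forall>l\<in>cj g ` L. cj l ` V = V"
  have Lc: "L \<subseteq> carrier G" and Vc: "V \<subseteq> carrier G" using L(2) V(1) subgroup.subset by auto
  define V' where "V' = cj (inv g) ` V"
  have "cj l ` V' = V'" if l: "l \<in> L" for l
  proof -
    have lc: "l \<in> carrier G" using l Lc by auto
    have "cj l ` V' = cj (l \<otimes> inv g) ` V" using g lc Vc unfolding V'_def by (simp add: cj_image_cj)
    also have "l \<otimes> inv g = inv g \<otimes> cj g l" using g lc by (simp add: conjugation_def m_assoc[symmetric])
    also have "cj (inv g \<otimes> cj g l) ` V = cj (inv g) ` cj (cj g l) ` V"
      using g lc Vc by (simp add: cj_image_cj)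
    finally show ?thesis using V(3) l unfolding V'_def by simp
  qed
  then have "Q L V'"
    using L(1) V g cj_image_subgroup[of "inv g" V] openin_cj_image[of "inv g" V]
    unfolding pro_def V'_def by simp
  then have "Q (cj g ` L) (cj g ` V')" by (rule Q_cj[OF g Lc])
  then show "Q (cj g ` L) V" using g Vc unfolding V'_def by simp
qed

text \<open>With \<open>C = core L (U \<inter> M)\<close>, both \<open>W\<close> and its conjugate by \<open>a\<close> are normal in
  \<open>W (L \<inter> C)\<close>, with quotients in the class.\<close>

lemma residual_normalised:
  assumes L: "subgroup L G" "compactin T L" "pro L" and a: "a \<in> L"
    and U: "subgroup U G" "openin T U" "compactin T U"
    and M: "subgroup M G" "openin T M" "\<And>g. g \<in> M \<Longrightarrow> cj g ` L = L"
    and W: "subgroup W G" "openin T W" "W \<subseteq> core L (U \<inter> M)" "\<And>u. u \<in> U \<Longrightarrow> cj u ` W = W"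
  shows "cj a ` residual W = residual W"
proof -
  \<comment> \<open>\<open>C\<close> is invariant under \<open>L\<close>. It lies in
    \<open>M\<close>, so that \<open>W\<close> normalises \<open>L\<close>, and in \<open>U\<close>,
    so that \<open>L \<inter> C\<close> normalises \<open>W\<close>.\<close>
  define C where "C = core L (U \<inter> M)"
  have UM: "subgroup (U \<inter> M) G" "openin T (U \<inter> M)" using U M by (auto intro: subgroups_Inter_pair)
  have one: "\<one> \<in> L" by (rule subgroup.one_closed[OF L(1)])
  have Lc: "L \<subseteq> carrier G" and Uc: "U \<subseteq> carrier G" and Wc: "W \<subseteq> carrier G"
    using L(1) U(1) W(1) by (simp_all add: subgroup.subset)
  have C: "subgroup C G" unfolding C_def using UM Lc one by (auto intro!: core_subgroup)
  have CUM: "C \<subseteq> U \<inter> M" unfolding C_def by (rule core_subset[OF one subgroup.subset[OF UM(1)]])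
  have CL: "cj l ` C = C" if "l \<in> L" for l
    unfolding C_def by (rule core_normalised[OF L(1) subgroup.subset[OF UM(1)] that])
  have WC: "W \<subseteq> C" using W(3) unfolding C_def .
  define N where "N = L \<inter> C"
  have N: "subgroup N G" unfolding N_def using L(1) C by (rule subgroups_Inter_pair)
  have Nc: "N \<subseteq> carrier G" by (rule subgroup.subset[OF N])
  have NU: "N \<subseteq> U" using CUM unfolding N_def by auto
  define X where "X = W <#> N"
  have WU: "W \<subseteq> U" using WC CUM by auto
  have "subgroup (W <#> N) (G\<lparr>carrier := U\<rparr>)"
  proof (rule mult_norm_sub_in_sub[OF _ _ U(1)])
    show "W \<lhd> G\<lparr>carrier := U\<rparr>"
      using normal_in_subgroup_iff[OF U(1) W(1)] WU W(4) by blast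
    show "subgroup N (G\<lparr>carrier := U\<rparr>)" using subgroup_restrict[OF U(1) N] NU by simp
  qed
  then have X: "subgroup X G" "X \<subseteq> U"
    unfolding X_def using subgroup_restrictD[OF U(1)] subgroup.subset by fastforce+
  have WX: "W \<subseteq> X" unfolding X_def set_mult_def using subgroup.one_closed[OF N] Wc by force
  have NX: "N \<subseteq> X" unfolding X_def set_mult_def using subgroup.one_closed[OF W(1)] Nc by force
  have Xo: "openin T X" by (rule openin_subgroupI[OF X(1) W(2) WX subgroup.one_closed[OF W(1)]])
  have Xcomp: "compactin T X" by (rule closedin_compact_subset[OF U(3) closedin_open_subgroup[OF X(1) Xo] X(2)])
  have XW: "cj x ` W = W" if "x \<in> X" for x using W(4) X(2) that by blast
  \<comment> \<open>\<open>W\<close> need not be invariant under \<open>L\<close>, so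
    \<open>pro L\<close> is applied to its core and the result is enlarged to
    \<open>W\<close>.\<close>
  have "Q L (core L W)"
  proof -
    have "subgroup (core L W) G" "openin T (core L W)"
      using L(2) W(1,2) Lc one by (auto intro!: core_subgroup core_openin)
    then show ?thesis
      using L(3) core_normalised[OF L(1) Wc] unfolding pro_def by blast
  qed
  then have "Q N W"
    using Q_sub[of L _ N] Q_super core_subset[OF one Wc] unfolding N_def by blast
  moreover have "W \<lhd> G\<lparr>carrier := X\<rparr>" using normal_in_subgroup_iff[OF X(1) W(1)] WX XW by blast
  ultimately have QXW: "Q X W" using Q_mult[OF X(1) _ N NX] unfolding X_def by blast
  have LX: "cj l ` X \<subseteq> X" if l: "l \<in> L" for l
  proof
    fix y assume "y \<in> cj l ` X"
    then obtain w n where wn: "w \<in> W" "n \<in> N" "y = cj l (w \<otimes> n)" unfolding X_def set_mult_def by auto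
    have c: "l \<in> carrier G" "w \<in> carrier G" "n \<in> carrier G" using l wn Lc Wc Nc by auto
    \<comment> \<open>Conjugation by \<open>l\<close> changes \<open>w\<close> by a commutator,
      which lies in \<open>C\<close> by invariance of \<open>C\<close> and in \<open>L\<close>
      because \<open>w\<close> normalises \<open>L\<close>. So the change is absorbed by
      \<open>N\<close>.\<close>
    have "inv w \<otimes> cj l w \<in> C"
      using wn(1) WC CL[OF l] C by (auto intro!: subgroup.m_closed[OF C] subgroup.m_inv_closed[OF C])
    moreover have "inv w \<otimes> cj l w \<in> L"
    proof -
      have "inv w \<in> M" using wn(1) WC CUM M(1) by (auto intro: subgroup.m_inv_closed)
      then have "cj (inv w) l \<in> L" using M(3) l by blast
      then have "cj (inv w) l \<otimes> inv l \<in> L"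
        using l by (intro subgroup.m_closed[OF L(1)] subgroup.m_inv_closed[OF L(1)])
      moreover have "cj (inv w) l \<otimes> inv l = inv w \<otimes> cj l w"
        using c by (simp add: conjugation_def m_assoc)
      ultimately show ?thesis by simp
    qed
    moreover have "cj l n \<in> N"
      using wn(2) CL[OF l] cj_image_self[OF L(1) l] unfolding N_def by blast
    ultimately have "(inv w \<otimes> cj l w) \<otimes> cj l n \<in> N"
      by - (rule subgroup.m_closed[OF N], auto simp: N_def)
    moreover have "y = w \<otimes> ((inv w \<otimes> cj l w) \<otimes> cj l n)"
    proof -
      have "y = cj l w \<otimes> cj l n"
        using wn(3) c group_hom.hom_mult[OF cj_hom[OF c(1)]] by simp
      also have "\<dots> = w \<otimes> ((inv w \<otimes> cj l w) \<otimes> cj l n)"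
        using c by (simp add: m_assoc[symmetric])
      finally show ?thesis .
    qed
    ultimately show "y \<in> X" using wn(1) unfolding X_def set_mult_def by blast
  qed
  have aX: "cj a ` X = X" by (rule cj_image_normalised[OF L(1) subgroup.subset[OF X(1)] LX a])
  have ac: "a \<in> carrier G" using a Lc by auto
  \<comment> \<open>\<open>a\<close> normalises \<open>X\<close>, hence its residual, which is also
    that of \<open>W\<close>; \<open>W\<close> itself may be moved by \<open>a\<close>.\<close>
  have "residual X = residual W" by (rule residual_eq[OF X(1) Xo Xcomp W(1,2) WX XW QXW])
  then show ?thesis using cj_residual[OF ac X(1) Xo] aX by simp
qed

end

locale class_S_section_class = class_S G T + section_class G Q
  for G (structure) and T and Q
begin

sublocale topological_section_class G T Q ..

theorem locally_pro:
  assumes L: "locally_normal G T L" "compactin T L" "L \<noteq> {\<one>}" "pro L"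
    and U: "subgroup U G" "openin T U" "compactin T U"
  shows "\<exists>W. subgroup W G \<and> openin T W \<and> W \<subseteq> U \<and> (\<forall>N. subgroup N G \<and> openin T N \<longrightarrow> Q W N)"
proof -
  have Ls: "subgroup L G" using L(1) unfolding locally_normal_def by simp
  have Lc: "L \<subseteq> carrier G" by (rule subgroup.subset[OF Ls])
  have Uc: "U \<subseteq> carrier G" by (rule subgroup.subset[OF U(1)])
  define M where "M K = {g \<in> carrier G. cj g ` K = K}" for K
  have M: "subgroup (M L) G" "openin T (M L)"
    using normaliser_subgroup[OF Lc] normalizer_eq[OF Lc] L(1) unfolding M_def locally_normal_def by auto
  obtain A where A: "finite A" "A \<subseteq> (\<Union>g\<in>carrier G. cj g ` L)" "generate G (U \<union> A) = carrier G"
    using generated_by_open_subgroup_and_conjugates[OF Ls L(3) U(1,2)] .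
  have Ac: "A \<subseteq> carrier G" using A(2) cj_image_subset[OF _ Lc] by blast
  have "\<exists>K. subgroup K G \<and> compactin T K \<and> pro K \<and> a \<in> K \<and> subgroup (M K) G \<and> openin T (M K)"
    if a: "a \<in> A" for a
  proof -
    obtain g where g: "g \<in> carrier G" "a \<in> cj g ` L" using a A(2) by blast
    let ?K = "cj g ` L"
    have K: "subgroup ?K G" by (rule cj_image_subgroup[OF g(1) Ls])
    have MK: "subgroup (M ?K) G" unfolding M_def by (rule normaliser_subgroup[OF subgroup.subset[OF K]])
    have "cj g ` M L \<subseteq> M ?K"
    proof
      fix y assume "y \<in> cj g ` M L"
      then obtain x where x: "x \<in> carrier G" "cj x ` L = L" "y = cj g x" unfolding M_def by auto
      have "cj y ` ?K = cj (y \<otimes> g) ` L" using x(1,3) g Lc by (simp add: cj_image_cj)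
      also have "y \<otimes> g = g \<otimes> x" using x(1,3) g by (simp add: conjugation_def m_assoc)
      also have "cj (g \<otimes> x) ` L = cj g ` cj x ` L" using x(1) g Lc by (simp add: cj_image_cj)
      finally show "y \<in> M ?K" using x g unfolding M_def by simp
    qed
    then have "openin T (M ?K)"
      using openin_subgroupI[OF MK openin_cj_image[OF g(1) M(2)]]
        subgroup.one_closed[OF cj_image_subgroup[OF g(1) M(1)]] by blast
    then show ?thesis
      using K MK g(2) compactin_cj_image[OF g(1) L(2)] pro_cj[OF L(4) Ls g(1)] by blast
  qed
  then obtain K where K: "\<And>a. a \<in> A \<Longrightarrow> subgroup (K a) G \<and> compactin T (K a) \<and> pro (K a) \<and> a \<in> K a \<and>
      subgroup (M (K a)) G \<and> openin T (M (K a))" by metis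
  define V where "V a = core (K a) (U \<inter> M (K a))" for a
  have V: "subgroup (V a) G \<and> openin T (V a)" if a: "a \<in> A" for a
  proof -
    have "subgroup (U \<inter> M (K a)) G" "openin T (U \<inter> M (K a))"
      using K[OF a] U by (auto intro: subgroups_Inter_pair)
    then show ?thesis
      unfolding V_def using K[OF a] subgroup.subset[of "K a" G] by (auto intro!: core_subgroup core_openin)
  qed
  \<comment> \<open>Finiteness of \<open>A\<close> keeps this intersection open. Its core under
    \<open>U\<close> is then normalised by \<open>U\<close> and lies in every \<open>V a\<close>,
    the two conditions under which \<open>a\<close> normalises the residual.\<close>
  define V' where "V' = \<Inter>(insert U (V ` A))"
  have V': "subgroup V' G" unfolding V'_def by (rule subgroups_Inter) (use V U in auto)
  have V'o: "openin T V'" unfolding V'_def by (rule openin_Inter) (use V U A(1) in auto)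
  define W where "W = core U V'"
  have W: "subgroup W G" "openin T W"
    unfolding W_def using V' V'o U Uc subgroup.one_closed[OF U(1)] by (auto intro!: core_subgroup core_openin)
  have WV: "W \<subseteq> V'"
    unfolding W_def using core_subset[OF subgroup.one_closed[OF U(1)] subgroup.subset[OF V']] .
  have WU: "W \<subseteq> U" using WV unfolding V'_def by auto
  have UW: "cj u ` W = W" if "u \<in> U" for u
    unfolding W_def by (rule core_normalised[OF U(1) subgroup.subset[OF V'] that])
  have Wcomp: "compactin T W"
    by (rule closedin_compact_subset[OF U(3) closedin_open_subgroup[OF W] WU])
  have "residual W \<lhd> G"
  proof (rule normalI_generators[OF A(3) residual_subgroup[OF W] Uc _ Ac])
    show "cj u ` residual W = residual W" if "u \<in> U" for u
      using cj_residual[OF _ W, of u] UW[OF that] that Uc by auto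
    show "cj a ` residual W = residual W" if a: "a \<in> A" for a
    proof (rule residual_normalised[of "K a" a U "M (K a)"])
      show "W \<subseteq> core (K a) (U \<inter> M (K a))" using WV a unfolding V'_def V_def by auto
      show "cj g ` K a = K a" if "g \<in> M (K a)" for g using that unfolding M_def by simp
    qed (use K[OF a] U W UW in auto)
  qed
  moreover have "compactin T (residual W)"
    by (rule closedin_compact_subset[OF Wcomp residual_closedin[OF W] residual_subset[OF W]])
  ultimately have "residual W = {\<one>}" by (rule compact_normal_trivial[rotated])
  then show ?thesis using W WU residual_trivial_imp[OF W Wcomp] by blast
qed

end

section \<open>Pi-groups and soluble groups\<close>

context group
begin

text \<open>By Cauchy's theorem a finite group is a \<open>\<pi>\<close>-group iff all its element orders are
  \<open>\<pi>\<close>-numbers.\<close>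

definition pi_quotient :: "nat set \<Rightarrow> 'a set \<Rightarrow> 'a set \<Rightarrow> bool" where
  "pi_quotient \<pi> X N \<longleftrightarrow>
     (\<forall>x\<in>X. \<exists>m::nat. m > 0 \<and> (\<forall>p. prime p \<and> p dvd m \<longrightarrow> p \<in> \<pi>) \<and> x [^] m \<in> N)"

text \<open>The derived series of \<open>X\<close> maps onto that of a quotient, so for normal
  \<open>N\<close> the number \<open>k\<close> bounds the derived length of \<open>X\<close> modulo
  \<open>N\<close>.\<close>

definition soluble_quotient :: "'a set \<Rightarrow> 'a set \<Rightarrow> bool" where
  "soluble_quotient X N \<longleftrightarrow> (\<exists>k. (derived G ^^ k) X \<subseteq> N)"

text \<open>Modulo \<open>K\<close> the factor \<open>k\<close> disappears; concretely, moving it to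
  the left past \<open>y [^] m\<close> conjugates it inside \<open>K\<close>.\<close>

lemma pow_mult_mod_normal:
  assumes X: "subgroup X G" and K: "K \<lhd> G\<lparr>carrier := X\<rparr>" and k: "k \<in> K" and y: "y \<in> X"
  shows "\<exists>k'\<in>K. (k \<otimes> y) [^] (m::nat) = k' \<otimes> y [^] m"
proof (induction m)
  have Ks: "subgroup K G" using K X normal_imp_subgroup subgroup_restrictD by blast
  case 0
  show ?case using subgroup.one_closed[OF Ks] by force
next
  have Ks: "subgroup K G" using K X normal_imp_subgroup subgroup_restrictD by blast
  case (Suc m)
  then obtain k' where k': "k' \<in> K" "(k \<otimes> y) [^] m = k' \<otimes> y [^] m" by blast
  have c: "y \<in> carrier G" "k \<in> carrier G" "k' \<in> carrier G"
    using k k' y subgroup.subset[OF X] subgroup.subset[OF Ks] by auto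
  have "y [^] m \<in> X" using y X by (induction m) (auto intro: subgroup.one_closed subgroup.m_closed)
  then have "cj (y [^] m) k \<in> K" using K k unfolding normal_in_subgroup_iff[OF X Ks] by blast
  then have "k' \<otimes> cj (y [^] m) k \<in> K" using k' by (intro subgroup.m_closed[OF Ks])
  moreover have "(k \<otimes> y) [^] Suc m = (k' \<otimes> cj (y [^] m) k) \<otimes> y [^] Suc m"
    using c k'(2) by (simp add: conjugation_def m_assoc) (simp add: m_assoc[symmetric])
  ultimately show ?case by blast
qed

lemma exp_of_derived_consistent:
  assumes H: "subgroup H G" and "K \<subseteq> H"
  shows "(derived (G\<lparr>carrier := H\<rparr>) ^^ n) K = (derived G ^^ n) K"
proof (induction n)
  case (Suc n)
  have "(derived G ^^ n) K \<subseteq> H"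
    using assms(2) by (induction n) (auto dest: derived_incl[OF _ H])
  then show ?case using Suc derived_consistent[OF _ H] by simp
qed simp

lemma exp_of_derived_subset:
  assumes "subgroup H G"
  shows "(derived G ^^ n) H \<subseteq> H"
  by (induction n) (auto dest: derived_incl[OF _ assms])

text \<open>With exponents in place of group orders, closure under extensions becomes the fact that
  a product of \<pi>-numbers is a \<pi>-number.\<close>

lemma section_class_pi: "section_class G (pi_quotient \<pi>)"
proof
  fix X Y N N' :: "'a set"
  show "pi_quotient \<pi> X X" if "X \<subseteq> carrier G"
    unfolding pi_quotient_def using that by (auto intro!: exI[of _ "1::nat"] simp: nat_pow_eone)
  show "pi_quotient \<pi> Y N" if "pi_quotient \<pi> X N" "Y \<subseteq> X"
    using that unfolding pi_quotient_def by blast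
  show "pi_quotient \<pi> X N'" if "pi_quotient \<pi> X N" "N \<subseteq> N'"
    using that unfolding pi_quotient_def by blast
  show "pi_quotient \<pi> X N" if Xc: "X \<subseteq> carrier G" and XY: "pi_quotient \<pi> X Y" and YN: "pi_quotient \<pi> Y N"
    unfolding pi_quotient_def
  proof
    fix x assume x: "x \<in> X"
    obtain m :: nat where m: "m > 0" "\<forall>p. prime p \<and> p dvd m \<longrightarrow> p \<in> \<pi>" "x [^] m \<in> Y"
      using XY x unfolding pi_quotient_def by blast
    obtain k :: nat where k: "k > 0" "\<forall>p. prime p \<and> p dvd k \<longrightarrow> p \<in> \<pi>" "(x [^] m) [^] k \<in> N"
      using YN m(3) unfolding pi_quotient_def by blast
    have "x [^] (m * k) \<in> N" using k(3) x Xc by (simp add: nat_pow_pow subsetD)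
    then show "\<exists>m::nat. m > 0 \<and> (\<forall>p. prime p \<and> p dvd m \<longrightarrow> p \<in> \<pi>) \<and> x [^] m \<in> N"
      using m k by (intro exI[of _ "m * k"]) (auto simp: prime_dvd_mult_iff)
  qed
  show "pi_quotient \<pi> X (X \<inter> N)" if X: "subgroup X G" and XN: "pi_quotient \<pi> X N"
  proof -
    have "x [^] (m::nat) \<in> X" if "x \<in> X" for x m
      using that X by (induction m) (auto intro: subgroup.one_closed subgroup.m_closed)
    then show ?thesis using XN unfolding pi_quotient_def by blast
  qed
  show "pi_quotient \<pi> X K"
    if X: "subgroup X G" and K: "K \<lhd> G\<lparr>carrier := X\<rparr>" and Y: "subgroup Y G" "Y \<subseteq> X"
      and XKY: "X \<subseteq> K <#> Y" and YK: "pi_quotient \<pi> Y K" for K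
    unfolding pi_quotient_def
  proof
    have Ks: "subgroup K G" using K X normal_imp_subgroup subgroup_restrictD by blast
    fix x assume "x \<in> X"
    then obtain k y where ky: "k \<in> K" "y \<in> Y" "x = k \<otimes> y" using XKY unfolding set_mult_def by blast
    obtain m :: nat where m: "m > 0" "\<forall>p. prime p \<and> p dvd m \<longrightarrow> p \<in> \<pi>" "y [^] m \<in> K"
      using YK ky(2) unfolding pi_quotient_def by blast
    have "x [^] m \<in> K"
      using pow_mult_mod_normal[OF X K ky(1), of y m] ky Y(2) m(3) subgroup.m_closed[OF Ks] by fastforce
    then show "\<exists>m::nat. m > 0 \<and> (\<forall>p. prime p \<and> p dvd m \<longrightarrow> p \<in> \<pi>) \<and> x [^] m \<in> K"
      using m by blast
  qed
  show "pi_quotient \<pi> (cj g ` X) (cj g ` N)"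
    if g: "g \<in> carrier G" and Xc: "X \<subseteq> carrier G" and XN: "pi_quotient \<pi> X N" for g
    unfolding pi_quotient_def
  proof
    fix y assume "y \<in> cj g ` X"
    then obtain x where x: "x \<in> X" "y = cj g x" by blast
    obtain m :: nat where m: "m > 0" "\<forall>p. prime p \<and> p dvd m \<longrightarrow> p \<in> \<pi>" "x [^] m \<in> N"
      using XN x(1) unfolding pi_quotient_def by blast
    have "y [^] m = cj g (x [^] m)"
      using group_hom.hom_nat_pow[OF cj_hom[OF g], of x m] x Xc by auto
    then show "\<exists>m::nat. m > 0 \<and> (\<forall>p. prime p \<and> p dvd m \<longrightarrow> p \<in> \<pi>) \<and> y [^] m \<in> cj g ` N"
      using m by blast
  qed
qed

lemma section_class_soluble: "section_class G soluble_quotient"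
proof
  fix X Y N N' :: "'a set"
  show "soluble_quotient X X" unfolding soluble_quotient_def by (auto intro: exI[of _ 0])
  show "soluble_quotient Y N" if "soluble_quotient X N" "Y \<subseteq> X"
    using that mono_exp_of_derived unfolding soluble_quotient_def by (meson order_trans)
  show "soluble_quotient X N'" if "soluble_quotient X N" "N \<subseteq> N'"
    using that unfolding soluble_quotient_def by (meson order_trans)
  show "soluble_quotient X N" if XY: "soluble_quotient X Y" and YN: "soluble_quotient Y N"
  proof -
    obtain j k where jk: "(derived G ^^ j) X \<subseteq> Y" "(derived G ^^ k) Y \<subseteq> N"
      using XY YN unfolding soluble_quotient_def by blast
    have "(derived G ^^ (k + j)) X \<subseteq> (derived G ^^ k) Y"
      using mono_exp_of_derived[OF jk(1)] by (simp add: funpow_add)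
    then show ?thesis using jk(2) unfolding soluble_quotient_def by blast
  qed
  show "soluble_quotient X (X \<inter> N)" if "subgroup X G" "soluble_quotient X N"
    using that exp_of_derived_subset unfolding soluble_quotient_def by blast
  show "soluble_quotient X K"
    if X: "subgroup X G" and K: "K \<lhd> G\<lparr>carrier := X\<rparr>" and Y: "subgroup Y G" "Y \<subseteq> X"
      and XKY: "X \<subseteq> K <#> Y" and YK: "soluble_quotient Y K" for K
  proof -
    have Ks: "subgroup K G" using K X normal_imp_subgroup subgroup_restrictD by blast
    have Xc: "X \<subseteq> carrier G" by (rule subgroup.subset[OF X])
    interpret K: normal K "G\<lparr>carrier := X\<rparr>" by (rule K)
    interpret h: group_hom "G\<lparr>carrier := X\<rparr>" "G\<lparr>carrier := X\<rparr> Mod K" "\<lambda>x. K #> x"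
      using K.r_coset_hom_Mod K.factorgroup_is_group K.is_group
      by (auto simp: group_hom_def group_hom_axioms_def)
    obtain k where k: "(derived G ^^ k) Y \<subseteq> K" using YK unfolding soluble_quotient_def by blast
    \<comment> \<open>As \<open>X\<close> is the product of \<open>K\<close> and \<open>Y\<close>,
      both have the same image modulo \<open>K\<close>, and hence so do the terms of their derived
      series.\<close>
    have "(\<lambda>x. K #> x) ` X = (\<lambda>x. K #> x) ` Y"
    proof
      show "(\<lambda>x. K #> x) ` X \<subseteq> (\<lambda>x. K #> x) ` Y"
      proof clarify
        fix x assume "x \<in> X"
        then obtain k y where ky: "k \<in> K" "y \<in> Y" "x = k \<otimes> y" using XKY unfolding set_mult_def by blast
        have c: "K \<subseteq> carrier G" "k \<in> carrier G" "y \<in> carrier G"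
          using ky Y(2) Xc subgroup.subset[OF Ks] by auto
        have "K #> x = (K #> k) #> y" using ky(3) c by (simp add: coset_mult_assoc)
        also have "K #> k = K" using ky(1) c Ks by (intro coset_join2)
        finally have "K #> x = K #> y" .
        then show "K #> x \<in> (\<lambda>x. K #> x) ` Y" using ky by blast
      qed
    qed (use Y(2) in blast)
    then have "(\<lambda>x. K #> x) ` ((derived G ^^ k) X) = (\<lambda>x. K #> x) ` ((derived G ^^ k) Y)"
      using h.exp_of_derived_img[of X k] h.exp_of_derived_img[of Y k] Y(2)
        exp_of_derived_consistent[OF X, of X k] exp_of_derived_consistent[OF X, of Y k] by simp
    moreover have "K #> x = K" if "x \<in> K" for x
      using that Ks subgroup.subset[OF Ks] by (intro coset_join2) auto
    ultimately have img: "K #> x = K" if "x \<in> (derived G ^^ k) X" for x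
      using that k by blast
    have "(derived G ^^ k) X \<subseteq> K"
    proof
      fix x assume x: "x \<in> (derived G ^^ k) X"
      then have "x \<in> carrier G" using exp_of_derived_in_carrier[OF Xc] by blast
      then show "x \<in> K" using img[OF x] coset_join1[OF _ _ Ks] subgroup.subset[OF Ks] by blast
    qed
    then show ?thesis unfolding soluble_quotient_def by blast
  qed
  show "soluble_quotient (cj g ` X) (cj g ` N)"
    if g: "g \<in> carrier G" and Xc: "X \<subseteq> carrier G" and XN: "soluble_quotient X N" for g
    using XN group_hom.exp_of_derived_img[OF cj_hom[OF g] Xc]
    unfolding soluble_quotient_def by (metis image_mono)
qed

end

text \<open>The part of Cauchy's theorem used below, drawn from Sylow: the order of a non-trivial
  element of a Sylow \<open>p\<close>-subgroup is a positive power of \<open>p\<close>.\<close>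

lemma (in group) prime_dvd_order_imp_element:
  assumes "finite (carrier G)" "prime p" "p dvd order G"
  obtains x where "x \<in> carrier G" "p dvd ord x"
proof -
  have pos: "order G > 0" using assms order_gt_0_iff_finite by blast
  define a where "a = multiplicity p (order G)"
  have "p ^ a dvd order G" unfolding a_def by (rule multiplicity_dvd)
  then obtain m where m: "order G = p ^ a * m" by blast
  obtain P where P: "subgroup P G" "card P = p ^ a" using sylow_thm[OF assms(2) is_group m assms(1)] by blast
  have "a > 0" unfolding a_def using assms(2,3) pos by (simp add: prime_multiplicity_gt_zero_iff)
  then have "card P > 1" using prime_gt_1_nat[OF assms(2)] P(2) one_less_power[of p a] by simp
  then have "P \<noteq> {\<one>}" by auto
  then obtain x where x: "x \<in> P" "x \<noteq> \<one>" using subgroup.one_closed[OF P(1)] by blast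
  have xc: "x \<in> carrier G" using x P(1) subgroup.mem_carrier by metis
  have "ord x dvd card P"
  proof -
    have "x [^]\<^bsub>G\<lparr>carrier := P\<rparr>\<^esub> order (G\<lparr>carrier := P\<rparr>) = \<one>\<^bsub>G\<lparr>carrier := P\<rparr>\<^esub>"
      using x(1) by (intro group.pow_order_eq_1[OF subgroup_imp_group[OF P(1)]]) simp
    then have "x [^] card P = \<one>" by (simp add: order_def nat_pow_consistent[symmetric])
    then show ?thesis using pow_eq_id[OF xc] by simp
  qed
  then obtain i where "ord x = p ^ i" using P(2) divides_primepow_nat[OF assms(2)] by auto
  moreover have "ord x \<noteq> 1" using x xc ord_eq_1 by blast
  ultimately have "p dvd ord x" by (cases i) auto
  then show ?thesis using that xc by blast
qed

lemma (in normal) pow_mem_iff_FactGroup: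
  assumes "x \<in> carrier G"
  shows "(H #> x) [^]\<^bsub>G Mod H\<^esub> (m::nat) = \<one>\<^bsub>G Mod H\<^esub> \<longleftrightarrow> x [^] m \<in> H"
  using assms FactGroup_pow[OF assms] coset_join1[OF _ _ is_subgroup] coset_join2[OF _ is_subgroup]
  by (metis nat_pow_closed one_FactGroup subset)

text \<open>In one direction the order of the quotient is an exponent valid for all elements. In the
  other, a prime dividing that order divides the order of some element, hence the \<pi>-number that
  annihilates it.\<close>

lemma (in normal) finite_pi_group_FactGroup:
  assumes "finite (carrier (G Mod H))"
  shows "finite_pi_group \<pi> (G Mod H) \<longleftrightarrow> pi_quotient \<pi> (carrier G) H"
proof
  interpret F: group "G Mod H" by (rule factorgroup_is_group)
  have carr: "carrier (G Mod H) = (\<lambda>x. H #> x) ` carrier G" by (rule carrier_FactGroup)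
  show "pi_quotient \<pi> (carrier G) H" if "finite_pi_group \<pi> (G Mod H)"
    unfolding pi_quotient_def
  proof
    fix x assume x: "x \<in> carrier G"
    have "x [^] order (G Mod H) \<in> H"
      using F.pow_order_eq_1[of "H #> x"] pow_mem_iff_FactGroup[OF x] x carr by auto
    moreover have "order (G Mod H) > 0" using assms F.order_gt_0_iff_finite by blast
    ultimately show "\<exists>m::nat. m > 0 \<and> (\<forall>p. prime p \<and> p dvd m \<longrightarrow> p \<in> \<pi>) \<and> x [^] m \<in> H"
      using that unfolding finite_pi_group_def by blast
  qed
  show "finite_pi_group \<pi> (G Mod H)" if Q: "pi_quotient \<pi> (carrier G) H"
    unfolding finite_pi_group_def
  proof (intro conjI allI impI)
    fix p assume "prime p \<and> p dvd order (G Mod H)"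
    then have p: "prime p" "p dvd order (G Mod H)" by auto
    obtain y where y: "y \<in> carrier (G Mod H)" "p dvd F.ord y"
      using F.prime_dvd_order_imp_element[OF assms p] .
    then obtain x where x: "x \<in> carrier G" "y = H #> x" using carr by auto
    obtain m :: nat where m: "\<forall>p. prime p \<and> p dvd m \<longrightarrow> p \<in> \<pi>" "x [^] m \<in> H"
      using Q x(1) unfolding pi_quotient_def by blast
    have "F.ord y dvd m" using F.pow_eq_id[OF y(1)] pow_mem_iff_FactGroup[OF x(1)] m(2) x(2) by simp
    then show "p \<in> \<pi>" using m(1) p(1) y(2) dvd_trans by blast
  qed (use assms F.is_group in auto)
qed

lemma (in normal) finite_soluble_group_FactGroup:
  assumes "finite (carrier (G Mod H))"
  shows "finite_soluble_group (G Mod H) \<longleftrightarrow> soluble_quotient (carrier G) H"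
proof -
  interpret F: group "G Mod H" by (rule factorgroup_is_group)
  interpret h: group_hom G "G Mod H" "\<lambda>x. H #> x"
    using r_coset_hom_Mod F.is_group is_group by (auto simp: group_hom_def group_hom_axioms_def)
  have D: "(derived (G Mod H) ^^ n) (carrier (G Mod H)) = (\<lambda>x. H #> x) ` ((derived G ^^ n) (carrier G))" for n
    using h.exp_of_derived_img[of "carrier G" n] by (simp add: carrier_FactGroup)
  have "(\<lambda>x. H #> x) ` ((derived G ^^ n) (carrier G)) = {\<one>\<^bsub>G Mod H\<^esub>} \<longleftrightarrow> (derived G ^^ n) (carrier G) \<subseteq> H" for n
  proof -
    have c: "(derived G ^^ n) (carrier G) \<subseteq> carrier G" by (rule exp_of_derived_in_carrier) simp
    have ne: "\<one> \<in> (derived G ^^ n) (carrier G)"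
      using exp_of_derived_is_subgroup[OF subgroup_self] subgroup.one_closed by blast
    have "H #> x = H \<longleftrightarrow> x \<in> H" if "x \<in> carrier G" for x
      using that coset_join1[OF _ _ is_subgroup] coset_join2[OF _ is_subgroup] subset by metis
    then have "(\<forall>x\<in>(derived G ^^ n) (carrier G). H #> x = H) \<longleftrightarrow> (derived G ^^ n) (carrier G) \<subseteq> H"
      using c by blast
    then show ?thesis using ne by auto
  qed
  then show ?thesis
    using assms F.is_group F.solvable_iff_trivial_derived_seq D
    unfolding finite_soluble_group_def soluble_quotient_def by simp
qed

context group
begin

lemma pi_quotient_restrict:
  assumes "subgroup K G"
  shows "group.pi_quotient (G\<lparr>carrier := K\<rparr>) \<pi> X N \<longleftrightarrow> pi_quotient \<pi> X N"
  unfolding pi_quotient_def group.pi_quotient_def[OF subgroup_imp_group[OF assms]]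
  by (simp add: nat_pow_consistent[symmetric])

lemma soluble_quotient_restrict:
  assumes "subgroup K G" "X \<subseteq> K"
  shows "group.soluble_quotient (G\<lparr>carrier := K\<rparr>) X N \<longleftrightarrow> soluble_quotient X N"
  unfolding soluble_quotient_def group.soluble_quotient_def[OF subgroup_imp_group[OF assms(1)]]
  by (simp add: exp_of_derived_consistent[OF assms])

end

section \<open>Profinite classes expressed by the section relations\<close>

context tdlc_group
begin

lemma finite_cosets:
  assumes K: "subgroup K G" "compactin T K" and N: "subgroup N G" "openin (subtopology T K) N"
  shows "finite ((\<lambda>x. N #> x) ` K)"
proof -
  obtain V where V: "openin T V" "N = V \<inter> K" using N(2) unfolding openin_subtopology by blast
  obtain F where F: "finite F" "F \<subseteq> K" "K \<subseteq> (\<Union>f\<in>F. (\<otimes>) f ` V)"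
    using compactin_open_cosets[OF K(2) V(1)] subgroup.one_closed[OF N(1)] V(2) by blast
  have Kc: "K \<subseteq> carrier G" and Nc: "N \<subseteq> carrier G" using K(1) N(1) subgroup.subset by auto
  \<comment> \<open>The cover consists of left cosets, whereas quotient groups are made of right
    cosets; applying it to the inverse of \<open>x\<close> switches sides.\<close>
  have "N #> x \<in> (\<lambda>f. N #> inv f) ` F" if x: "x \<in> K" for x
  proof -
    have "inv x \<in> K" using x K(1) by (simp add: subgroup.m_inv_closed)
    then obtain f v where f: "f \<in> F" "v \<in> V" "inv x = f \<otimes> v" using F(3) by auto
    have c: "x \<in> carrier G" "f \<in> carrier G" "v \<in> carrier G"
      using x f F(2) Kc openin_carrier[OF V(1)] by auto
    have "v = inv f \<otimes> inv x" using f(3) c by (simp add: m_assoc[symmetric])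
    then have "v \<in> K"
      using f(1) F(2) \<open>inv x \<in> K\<close> K(1) by (auto intro: subgroup.m_closed subgroup.m_inv_closed)
    then have v: "v \<in> N" using f(2) V(2) by simp
    have "x = inv v \<otimes> inv f"
      using f(3) c inv_inv[of x] by (simp add: inv_mult_group)
    then have "N #> x = (N #> inv v) #> inv f" using c Nc by (simp add: coset_mult_assoc)
    also have "N #> inv v = N" using v N(1) c by (intro coset_join2) (auto intro: subgroup.m_inv_closed)
    finally show ?thesis using f(1) by blast
  qed
  then have "(\<lambda>x. N #> x) ` K \<subseteq> (\<lambda>f. N #> inv f) ` F" by blast
  then show ?thesis using F(1) finite_subset by blast
qed

text \<open>Compactness settles profiniteness and the finiteness of each quotient, which leaves only
  the condition \<open>R\<close> on open normal subgroups.\<close>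

lemma pro_class_compact_subgroup_iff:
  assumes K: "subgroup K G" "compactin T K"
    and C: "\<And>N. N \<lhd> G\<lparr>carrier := K\<rparr> \<Longrightarrow> finite (carrier (G\<lparr>carrier := K\<rparr> Mod N)) \<Longrightarrow>
      C (G\<lparr>carrier := K\<rparr> Mod N) \<longleftrightarrow> R K N"
  shows "pro_class C (G\<lparr>carrier := K\<rparr>) (subtopology T K) \<longleftrightarrow>
    (\<forall>N. N \<lhd> G\<lparr>carrier := K\<rparr> \<and> openin (subtopology T K) N \<longrightarrow> R K N)"
proof -
  have "C (G\<lparr>carrier := K\<rparr> Mod N) \<longleftrightarrow> R K N"
    if N: "N \<lhd> G\<lparr>carrier := K\<rparr>" "openin (subtopology T K) N" for N
  proof (rule C[OF N(1)])
    have "subgroup N G" using N(1) K(1) normal_imp_subgroup subgroup_restrictD by blast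
    then show "finite (carrier (G\<lparr>carrier := K\<rparr> Mod N))"
      using finite_cosets[OF K _ N(2)] by (simp add: carrier_FactGroup)
  qed
  then show ?thesis
    using compact_subgroup_profinite[OF K] unfolding pro_class_def by blast
qed

lemma pro_pi_iff:
  assumes "subgroup K G" "compactin T K"
  shows "pro_pi \<pi> (G\<lparr>carrier := K\<rparr>) (subtopology T K) \<longleftrightarrow>
    (\<forall>N. N \<lhd> G\<lparr>carrier := K\<rparr> \<and> openin (subtopology T K) N \<longrightarrow> pi_quotient \<pi> K N)"
  unfolding pro_pi_def
  by (rule pro_class_compact_subgroup_iff[OF assms])
     (simp add: normal.finite_pi_group_FactGroup pi_quotient_restrict[OF assms(1)])

lemma prosoluble_iff:
  assumes "subgroup K G" "compactin T K"
  shows "prosoluble (G\<lparr>carrier := K\<rparr>) (subtopology T K) \<longleftrightarrow>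
    (\<forall>N. N \<lhd> G\<lparr>carrier := K\<rparr> \<and> openin (subtopology T K) N \<longrightarrow> soluble_quotient K N)"
  unfolding prosoluble_def
  by (rule pro_class_compact_subgroup_iff[OF assms])
     (simp add: normal.finite_soluble_group_FactGroup soluble_quotient_restrict[OF assms(1)])

end

section \<open>Virtual membership of compact open subgroups\<close>

context class_S_section_class
begin

lemma pro_if_relative:
  assumes L: "subgroup L G"
    and rel: "\<And>N. N \<lhd> G\<lparr>carrier := L\<rparr> \<Longrightarrow> openin (subtopology T L) N \<Longrightarrow> Q L N"
  shows "pro L"
  unfolding pro_def
proof (intro allI impI, elim conjE)
  fix V assume V: "subgroup V G" "openin T V" "\<forall>l\<in>L. cj l ` V = V"
  have LV: "subgroup (L \<inter> V) G" using L V(1) by (rule subgroups_Inter_pair)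
  have "cj l ` (L \<inter> V) \<subseteq> L \<inter> V" if "l \<in> L" for l
    using V(3) cj_image_self[OF L] that by blast
  then have "L \<inter> V \<lhd> G\<lparr>carrier := L\<rparr>" using normal_in_subgroup_iff[OF L LV] by blast
  moreover have "openin (subtopology T L) (L \<inter> V)" using V(2) by (rule openin_subtopology_Int2)
  ultimately have "Q L (L \<inter> V)" by (rule rel)
  then show "Q L V" by (rule Q_super) simp
qed

text \<open>Stated for any property \<open>P\<close> that \<open>Q\<close> tests on open normal
  subgroups, so that the pro-\<pi> and the prosoluble case are two instances.\<close>

lemma virtually_pro_class:
  assumes P: "\<And>K. subgroup K G \<Longrightarrow> compactin T K \<Longrightarrow>
      P (G\<lparr>carrier := K\<rparr>) (subtopology T K) \<longleftrightarrow>
      (\<forall>N. N \<lhd> G\<lparr>carrier := K\<rparr> \<and> openin (subtopology T K) N \<longrightarrow> Q K N)"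
    and L: "locally_normal G T L" "compactin T L" "L \<noteq> {\<one>}" "P (G\<lparr>carrier := L\<rparr>) (subtopology T L)"
    and U: "subgroup U G" "compactin T U" "openin T U"
  shows "virtually P (G\<lparr>carrier := U\<rparr>) (subtopology T U)"
proof -
  have Ls: "subgroup L G" using L(1) unfolding locally_normal_def by simp
  have proL: "pro L" using pro_if_relative[OF Ls] P[OF Ls L(2)] L(4) by blast
  obtain W where W: "subgroup W G" "openin T W" "W \<subseteq> U"
      "\<And>N. subgroup N G \<Longrightarrow> openin T N \<Longrightarrow> Q W N"
    using locally_pro[OF L(1-3) proL U(1,3,2)] by auto
  have Wcomp: "compactin T W"
    by (rule closedin_compact_subset[OF U(2) closedin_open_subgroup[OF W(1,2)] W(3)])
  have "Q W N" if N: "N \<lhd> G\<lparr>carrier := W\<rparr>" "openin (subtopology T W) N" for N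
  proof (rule W(4))
    show "subgroup N G" using N(1) W(1) normal_imp_subgroup subgroup_restrictD by blast
    show "openin T N" using N(2) W(2) openin_trans_full by blast
  qed
  then have "P (G\<lparr>carrier := W\<rparr>) (subtopology T W)" using P[OF W(1) Wcomp] by blast
  moreover have "U \<inter> W = W" using W(3) by blast
  ultimately have "P (G\<lparr>carrier := U\<rparr>\<lparr>carrier := W\<rparr>) (subtopology (subtopology T U) W)"
    by (simp add: subtopology_subtopology)
  moreover have "subgroup W (G\<lparr>carrier := U\<rparr>)" using subgroup_restrict[OF U(1) W(1)] W(3) by simp
  moreover have "openin (subtopology T U) W" using W(2,3) by (simp add: openin_subtopology_alt) blast
  ultimately show ?thesis unfolding virtually_def by blast
qed

end

section \<open>Sylow pro-p subgroups\<close>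

text \<open>Maps with the same fibres have equinumerous images; it serves to compare the cosets of
  \<open>Y\<close> and of \<open>X \<inter> Y\<close> met by \<open>X\<close>.\<close>

lemma bij_betw_images_same_kernel:
  assumes "\<And>x y. x \<in> X \<Longrightarrow> y \<in> X \<Longrightarrow> f x = f y \<longleftrightarrow> g x = g y"
  shows "bij_betw (\<lambda>c. g (inv_into X f c)) (f ` X) (g ` X)"
proof (intro bij_betw_imageI inj_onI)
  have r: "inv_into X f c \<in> X" "f (inv_into X f c) = c" if "c \<in> f ` X" for c
    using that by (auto intro: inv_into_into f_inv_into_f)
  show "c = d" if "c \<in> f ` X" "d \<in> f ` X" "g (inv_into X f c) = g (inv_into X f d)" for c d
    using that r[of c] r[of d] assms by metis
  show "(\<lambda>c. g (inv_into X f c)) ` f ` X = g ` X"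
  proof
    show "(\<lambda>c. g (inv_into X f c)) ` f ` X \<subseteq> g ` X" using r by blast
    show "g ` X \<subseteq> (\<lambda>c. g (inv_into X f c)) ` f ` X"
    proof clarify
      fix x assume x: "x \<in> X"
      then have "g (inv_into X f (f x)) = g x" using r[of "f x"] assms by blast
      then show "g x \<in> (\<lambda>c. g (inv_into X f c)) ` f ` X" using x by (metis imageI)
    qed
  qed
qed

lemma finite_chain_least:
  assumes "finite F" "F \<noteq> {}" "\<And>a b. a \<in> F \<Longrightarrow> b \<in> F \<Longrightarrow> a \<subseteq> b \<or> b \<subseteq> a"
  shows "\<exists>m\<in>F. \<forall>a\<in>F. m \<subseteq> a"
  using assms
proof (induction rule: finite_ne_induct)
  case (insert x F)
  have "\<exists>m\<in>F. \<forall>a\<in>F. m \<subseteq> a" using insert.IH insert.prems by simp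
  then obtain m where m: "m \<in> F" "\<forall>a\<in>F. m \<subseteq> a" by (elim bexE)
  show ?case
  proof (cases "m \<subseteq> x")
    case True
    then show ?thesis using m by (intro bexI[of _ m]) auto
  next
    case False
    then have "x \<subseteq> m" using insert.prems[of m x] m(1) by auto
    then show ?thesis using m(2) by (intro bexI[of _ x]) (auto dest: subsetD)
  qed
qed auto

section \<open>Relative indices\<close>

context group
begin

text \<open>For subgroups this is the index of \<open>X \<inter> Y\<close> in \<open>X\<close>,
  without assuming that \<open>Y\<close> lies in \<open>X\<close>. An infinite index becomes 0,
  hence divisible by every number.\<close>

definition rel_index :: "'a set \<Rightarrow> 'a set \<Rightarrow> nat" where
  "rel_index X Y = card ((\<lambda>x. Y #> x) ` X)"

lemma r_coset_eq_iff:
  assumes "subgroup Y G" "x \<in> carrier G" "y \<in> carrier G"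
  shows "Y #> x = Y #> y \<longleftrightarrow> x \<otimes> inv y \<in> Y"
proof -
  have "x \<in> Y #> y \<longleftrightarrow> x \<otimes> inv y \<in> Y"
    using subgroup.rcos_module[OF assms(1) is_group assms(3,2)] .
  moreover have "x \<in> Y #> y \<longleftrightarrow> Y #> x = Y #> y"
    using repr_independence[OF _ assms(3,1), of x] rcos_self[OF assms(2,1)] by metis
  ultimately show ?thesis by simp
qed

lemma r_coset_Int_eq_iff:
  assumes "subgroup X G" "subgroup Y G" "x \<in> X" "y \<in> X"
  shows "Y #> x = Y #> y \<longleftrightarrow> (X \<inter> Y) #> x = (X \<inter> Y) #> y"
proof -
  have "x \<in> carrier G" "y \<in> carrier G" "x \<otimes> inv y \<in> X"
    using assms by (auto simp: subgroup.mem_carrier subgroup.m_closed subgroup.m_inv_closed)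
  then show ?thesis
    using r_coset_eq_iff[OF assms(2)] r_coset_eq_iff[OF subgroups_Inter_pair[OF assms(1,2)]] by simp
qed

lemma rel_index_Int:
  assumes "subgroup X G" "subgroup Y G"
  shows "rel_index X (X \<inter> Y) = rel_index X Y"
  unfolding rel_index_def
  using bij_betw_same_card[OF bij_betw_images_same_kernel[of X "\<lambda>x. Y #> x" "\<lambda>x. (X \<inter> Y) #> x"]]
    r_coset_Int_eq_iff[OF assms] by simp

text \<open>Once a representative \<open>r c\<close> of each coset \<open>c\<close> of
  \<open>Y\<close> is chosen, a coset of \<open>Z\<close> in \<open>X\<close> is uniquely
  \<open>D #> r c\<close> with \<open>D\<close> a coset of \<open>Z\<close> in \<open>Y\<close>. The
  value 0 for an infinite index is compatible with the product.\<close>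

lemma rel_index_mult:
  assumes X: "subgroup X G" and Y: "subgroup Y G" "Y \<subseteq> X" and Z: "subgroup Z G" "Z \<subseteq> Y"
  shows "rel_index X Z = rel_index X Y * rel_index Y Z"
proof -
  have Xc: "X \<subseteq> carrier G" by (rule subgroup.subset[OF X])
  have Zc: "Z \<subseteq> carrier G" by (rule subgroup.subset[OF Z(1)])
  define r where "r = inv_into X (\<lambda>x. Y #> x)"
  have r: "r c \<in> X" "Y #> r c = c" if "c \<in> (\<lambda>x. Y #> x) ` X" for c
    using inv_into_into[OF that] f_inv_into_f[OF that] unfolding r_def by simp_all
  have "bij_betw (\<lambda>(c, D). D #> r c) ((\<lambda>x. Y #> x) ` X \<times> (\<lambda>y. Z #> y) ` Y) ((\<lambda>x. Z #> x) ` X)"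
  proof (intro bij_betw_imageI inj_onI)
    fix u v assume u: "u \<in> (\<lambda>x. Y #> x) ` X \<times> (\<lambda>y. Z #> y) ` Y"
      and v: "v \<in> (\<lambda>x. Y #> x) ` X \<times> (\<lambda>y. Z #> y) ` Y"
      and eq: "(case u of (c, D) \<Rightarrow> D #> r c) = (case v of (c, D) \<Rightarrow> D #> r c)"
    obtain c y where cy: "u = (c, Z #> y)" "c \<in> (\<lambda>x. Y #> x) ` X" "y \<in> Y" using u by blast
    obtain d z where dz: "v = (d, Z #> z)" "d \<in> (\<lambda>x. Y #> x) ` X" "z \<in> Y" using v by blast
    have k: "r c \<in> carrier G" "r d \<in> carrier G" "y \<in> carrier G" "z \<in> carrier G"
      using r cy dz Xc Y(2) by auto
    have "Z #> (y \<otimes> r c) = Z #> (z \<otimes> r d)"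
      using eq cy dz k Zc by (simp add: coset_mult_assoc)
    then have e: "y \<otimes> r c \<otimes> inv (z \<otimes> r d) \<in> Z" using r_coset_eq_iff[OF Z(1)] k by simp
    then have "inv y \<otimes> (y \<otimes> r c \<otimes> inv (z \<otimes> r d)) \<otimes> z \<in> Y"
      using Z(2) cy(3) dz(3) Y(1) by (auto simp: subgroup.m_closed subgroup.m_inv_closed)
    moreover have "inv y \<otimes> (y \<otimes> r c \<otimes> inv (z \<otimes> r d)) \<otimes> z = r c \<otimes> inv (r d)"
    proof -
      have "inv y \<otimes> (y \<otimes> r c \<otimes> inv (z \<otimes> r d)) = (inv y \<otimes> y) \<otimes> (r c \<otimes> (inv (r d) \<otimes> inv z))"
        using k by (simp only: m_assoc inv_mult_group inv_closed m_closed)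
      also have "\<dots> \<otimes> z = r c \<otimes> inv (r d)" using k by (simp add: m_assoc)
      finally show ?thesis .
    qed
    ultimately have "Y #> r c = Y #> r d" using r_coset_eq_iff[OF Y(1)] k by simp
    then have cd: "c = d" using r cy dz by metis
    have "y \<otimes> r c \<otimes> inv (z \<otimes> r d) = y \<otimes> inv z"
    proof -
      have "y \<otimes> r c \<otimes> inv (z \<otimes> r d) = y \<otimes> ((r c \<otimes> inv (r c)) \<otimes> inv z)"
        unfolding cd[symmetric] using k by (simp only: m_assoc inv_mult_group inv_closed m_closed)
      then show ?thesis using k by simp
    qed
    then have "Z #> y = Z #> z" using e r_coset_eq_iff[OF Z(1)] k by simp
    then show "u = v" using cd cy dz by simp
  next
    show "(\<lambda>(c, D). D #> r c) ` ((\<lambda>x. Y #> x) ` X \<times> (\<lambda>y. Z #> y) ` Y) = (\<lambda>x. Z #> x) ` X"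
    proof (intro equalityI subsetI)
      fix E assume "E \<in> (\<lambda>(c, D). D #> r c) ` ((\<lambda>x. Y #> x) ` X \<times> (\<lambda>y. Z #> y) ` Y)"
      then obtain c y where cy: "c \<in> (\<lambda>x. Y #> x) ` X" "y \<in> Y" "E = (Z #> y) #> r c" by auto
      have "y \<in> carrier G" "r c \<in> carrier G" using cy(2) r(1)[OF cy(1)] Xc Y(2) by auto
      then have "E = Z #> (y \<otimes> r c)" using cy(3) Zc by (simp add: coset_mult_assoc)
      moreover have "y \<otimes> r c \<in> X" using cy r(1)[OF cy(1)] Y(2) subgroup.m_closed[OF X] by blast
      ultimately show "E \<in> (\<lambda>x. Z #> x) ` X" by blast
    next
      fix E assume "E \<in> (\<lambda>x. Z #> x) ` X"
      then obtain x where x: "x \<in> X" "E = Z #> x" by blast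
      define c where "c = Y #> x"
      have c: "c \<in> (\<lambda>x. Y #> x) ` X" using x unfolding c_def by blast
      have k: "x \<in> carrier G" "r c \<in> carrier G" using x r(1)[OF c] Xc by auto
      have y: "x \<otimes> inv (r c) \<in> Y"
        using r(2)[OF c] r_coset_eq_iff[OF Y(1) k] unfolding c_def by simp
      have "E = (Z #> (x \<otimes> inv (r c))) #> r c"
        using x(2) k Zc by (simp add: coset_mult_assoc m_assoc)
      then have "E = (\<lambda>(c, D). D #> r c) (c, Z #> (x \<otimes> inv (r c)))" by simp
      then show "E \<in> (\<lambda>(c, D). D #> r c) ` ((\<lambda>x. Y #> x) ` X \<times> (\<lambda>y. Z #> y) ` Y)"
        using c y by blast
    qed
  qed
  from bij_betw_same_card[OF this] show ?thesis
    unfolding rel_index_def by (simp add: card_cartesian_product)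
qed

lemma rel_index_FactGroup: "rel_index X N = order (G\<lparr>carrier := X\<rparr> Mod N)"
  by (simp add: rel_index_def order_def carrier_FactGroup)

text \<open>The image of \<open>P\<close> is a subgroup of the quotient group, so Lagrange's theorem
  applies there.\<close>

lemma rel_index_dvd:
  assumes K: "subgroup K G" and N: "N \<lhd> G\<lparr>carrier := K\<rparr>" and P: "subgroup P G" "P \<subseteq> K"
  shows "rel_index P N dvd rel_index K N"
proof -
  interpret N: normal N "G\<lparr>carrier := K\<rparr>" by (rule N)
  interpret h: group_hom "G\<lparr>carrier := K\<rparr>" "G\<lparr>carrier := K\<rparr> Mod N" "\<lambda>x. N #> x"
    using N.r_coset_hom_Mod N.factorgroup_is_group N.is_group
    by (auto simp: group_hom_def group_hom_axioms_def)
  have "subgroup P (G\<lparr>carrier := K\<rparr>)" using subgroup_restrict[OF K P(1)] P(2) by simp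
  then have "subgroup ((\<lambda>x. N #> x) ` P) (G\<lparr>carrier := K\<rparr> Mod N)"
    by (rule h.subgroup_img_is_subgroup)
  from h.H.lagrange[OF this] show ?thesis
    unfolding rel_index_FactGroup[of K N] unfolding rel_index_def by (metis dvd_triv_right)
qed

end

section \<open>Existence of Sylow pro-\<open>p\<close> subgroups\<close>

context tdlc_group
begin

lemma finite_cosets_open:
  assumes K: "subgroup K G" "compactin T K" and V: "subgroup V G" "openin T V"
  shows "finite ((\<lambda>x. V #> x) ` K)"
proof -
  have "finite ((\<lambda>x. (K \<inter> V) #> x) ` K)"
    using V(2) by (intro finite_cosets[OF K subgroups_Inter_pair[OF K(1) V(1)]] openin_subtopology_Int2)
  then show ?thesis
    using bij_betw_finite[OF bij_betw_images_same_kernel[of K "\<lambda>x. V #> x" "\<lambda>x. (K \<inter> V) #> x"]]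
      r_coset_Int_eq_iff[OF K(1) V(1)] by simp
qed

lemma closedin_r_coset:
  assumes V: "subgroup V G" "openin T V" and x: "x \<in> carrier G"
  shows "closedin T (V #> x)"
proof -
  have "V #> x = {y \<in> topspace T. y \<otimes> inv x \<in> V}"
    using subgroup.rcos_module[OF V(1) is_group x] r_coset_subset_G[OF subgroup.subset[OF V(1)] x]
    by (auto simp: topspace_eq)
  then show ?thesis
    using closedin_continuous_map_preimage[OF continuous_map_mult_right[of "inv x"] closedin_open_subgroup[OF V]] x
    by simp
qed

text \<open>\<open>H\<close> maps onto a subgroup containing a Sylow \<open>p\<close>-subgroup in every finite quotient of \<open>K\<close>.\<close>

definition p_full :: "nat \<Rightarrow> 'a set \<Rightarrow> 'a set \<Rightarrow> bool" where
  "p_full p K H \<longleftrightarrow> (\<forall>V k. subgroup V G \<and> openin T V \<and> (\<forall>x\<in>K. cj x ` V = V) \<and>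
     p ^ k dvd rel_index K V \<longrightarrow> p ^ k dvd rel_index H V)"

text \<open>For fixed \<open>V\<close> all images lie in one finite set of cosets, so the chain has
  a smallest image, and each coset in it meets every member of the chain. Compactness of
  \<open>K\<close> gives a point common to the coset and all members, so the intersection has that
  same image.\<close>

lemma p_full_Inter_chain:
  assumes K: "subgroup K G" "compactin T K"
    and C: "C \<noteq> {}" "\<And>H. H \<in> C \<Longrightarrow> subgroup H G \<and> closedin T H \<and> H \<subseteq> K \<and> p_full p K H"
    and chain: "\<And>H H'. H \<in> C \<Longrightarrow> H' \<in> C \<Longrightarrow> H \<subseteq> H' \<or> H' \<subseteq> H"
  shows "p_full p K (\<Inter>C)"
  unfolding p_full_def
proof (intro allI impI, elim conjE)
  fix V k assume V: "subgroup V G" "openin T V" "\<forall>x\<in>K. cj x ` V = V" and k: "p ^ k dvd rel_index K V"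
  define f where "f H = (\<lambda>x. V #> x) ` H" for H
  have fin: "finite (f H)" if "H \<in> C" for H
    using finite_cosets_open[OF K V(1,2)] C(2)[OF that] unfolding f_def by (meson finite_subset image_mono)
  obtain H0 where "H0 \<in> C" using C(1) by blast
  then obtain H where H: "H \<in> C" "\<And>H'. H' \<in> C \<Longrightarrow> card (f H) \<le> card (f H')"
    using ex_has_least_nat[of "\<lambda>H. H \<in> C" H0 "\<lambda>H. card (f H)"] by blast
  have fH: "f H \<subseteq> f H'" if H': "H' \<in> C" for H'
  proof (cases "H \<subseteq> H'")
    case True
    then show ?thesis unfolding f_def by blast
  next
    case False
    then have "f H' \<subseteq> f H" using chain[OF H(1) H'] unfolding f_def by blast
    then show ?thesis using card_seteq[OF fin[OF H(1)] _ H(2)[OF H']] by simp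
  qed
  have "f H \<subseteq> f (\<Inter>C)"
  proof
    fix c assume c: "c \<in> f H"
    then obtain x where x: "x \<in> H" "c = V #> x" unfolding f_def by blast
    have xc: "x \<in> carrier G" using x(1) C(2)[OF H(1)] subgroup.mem_carrier by metis
    have "K \<inter> \<Inter>((\<lambda>H'. H' \<inter> c) ` C) \<noteq> {}"
    proof -
      have "\<forall>D\<in>(\<lambda>H'. H' \<inter> c) ` C. closedin T D"
        using C(2) closedin_r_coset[OF V(1,2) xc] x(2) by blast
      moreover have "K \<inter> \<Inter>\<F> \<noteq> {}" if \<F>: "finite \<F>" "\<F> \<subseteq> (\<lambda>H'. H' \<inter> c) ` C" for \<F>
      proof -
        obtain F where F: "F \<subseteq> C" "finite F" "\<F> = (\<lambda>H'. H' \<inter> c) ` F"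
          using finite_subset_image[OF \<F>] by blast
        show ?thesis
        proof (cases "F = {}")
          case True
          then show ?thesis using F(3) subgroup.one_closed[OF K(1)] by auto
        next
          case False
          then obtain H1 where H1: "H1 \<in> F" "\<forall>H'\<in>F. H1 \<subseteq> H'"
            using finite_chain_least[OF F(2)] chain F(1) by blast
          then have "H1 \<in> C" using F(1) by blast
          then obtain z where z: "z \<in> H1" "c = V #> z" using fH c unfolding f_def by blast
          have "z \<in> carrier G" using z(1) C(2)[OF \<open>H1 \<in> C\<close>] subgroup.mem_carrier by metis
          then have "z \<in> c" using z(2) rcos_self V(1) by blast
          then have "z \<in> K \<inter> \<Inter>\<F>" using z(1) H1 F(3) C(2)[OF \<open>H1 \<in> C\<close>] by auto
          then show ?thesis by blast
        qed
      qed
      ultimately show ?thesis using K(2) unfolding compactin_fip by blast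
    qed
    then obtain z where z: "z \<in> \<Inter>C" "z \<in> c" using C(1) by auto
    then have "c = V #> z" using x(2) repr_independence[OF _ xc V(1), of z] by simp
    then show "c \<in> f (\<Inter>C)" using z(1) unfolding f_def by blast
  qed
  moreover have "f (\<Inter>C) \<subseteq> f H" using H(1) unfolding f_def by blast
  ultimately have "rel_index (\<Inter>C) V = rel_index H V" unfolding rel_index_def f_def by simp
  then show "p ^ k dvd rel_index (\<Inter>C) V"
    using C(2)[OF H(1)] V k unfolding p_full_def by auto
qed

text \<open>Counting the index of \<open>S \<inter> V\<close> in \<open>H\<close> in two ways leaves
  the power of \<open>p\<close> in the index of \<open>S \<inter> V\<close> in \<open>S\<close>. As
  \<open>p\<close> divides 0, the condition on \<open>rel_index H S\<close> also forces that index
  to be finite.\<close>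

lemma p_full_subgroup:
  assumes p: "prime p" and H: "subgroup H G" "p_full p K H" and S: "subgroup S G" "S \<subseteq> H"
    and nd: "\<not> p dvd rel_index H S"
  shows "p_full p K S"
  unfolding p_full_def
proof (intro allI impI, elim conjE)
  fix V k assume V: "subgroup V G" "openin T V" "\<forall>x\<in>K. cj x ` V = V" and k: "p ^ k dvd rel_index K V"
  have HV: "subgroup (H \<inter> V) G" and SV: "subgroup (S \<inter> V) G"
    using H(1) S(1) V(1) by (auto intro: subgroups_Inter_pair)
  have "p ^ k dvd rel_index H (H \<inter> V)"
    using H(2) V k rel_index_Int[OF H(1) V(1)] unfolding p_full_def by simp
  then have "p ^ k dvd rel_index H (S \<inter> V)"
    using rel_index_mult[OF H(1) HV _ SV] S(2) by (simp add: inf.coboundedI1 inf_mono)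
  then have "p ^ k dvd rel_index H S * rel_index S (S \<inter> V)"
    using rel_index_mult[OF H(1) S SV] by simp
  moreover have "coprime (p ^ k) (rel_index H S)" using p nd by (simp add: prime_imp_coprime)
  ultimately show "p ^ k dvd rel_index S V"
    using rel_index_Int[OF S(1) V(1)] by (simp add: coprime_dvd_mult_right_iff)
qed

text \<open>The preimage \<open>S\<close> of a Sylow \<open>p\<close>-subgroup of a finite quotient
  of \<open>P\<close> has index prime to \<open>p\<close>, so it is again \<open>p_full\<close>.
  Minimality gives \<open>S = P\<close>, and the quotient is a \<open>p\<close>-group.\<close>

lemma minimal_p_full_pro_p:
  assumes K: "subgroup K G" "compactin T K" and p: "prime p"
    and P: "subgroup P G" "closedin T P" "P \<subseteq> K" "p_full p K P"
    and min: "\<And>H. subgroup H G \<Longrightarrow> closedin T H \<Longrightarrow> H \<subseteq> P \<Longrightarrow> p_full p K H \<Longrightarrow> H = P"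
  shows "pro_pi {p} (G\<lparr>carrier := P\<rparr>) (subtopology T P)"
proof -
  have Pcomp: "compactin T P" by (rule closedin_compact_subset[OF K(2) P(2,3)])
  have "pi_quotient {p} P N" if N: "N \<lhd> G\<lparr>carrier := P\<rparr>" and No: "openin (subtopology T P) N" for N
  proof -
    interpret N: normal N "G\<lparr>carrier := P\<rparr>" by (rule N)
    interpret F: group "G\<lparr>carrier := P\<rparr> Mod N" by (rule N.factorgroup_is_group)
    interpret h: group_hom "G\<lparr>carrier := P\<rparr>" "G\<lparr>carrier := P\<rparr> Mod N" "\<lambda>x. N #> x"
      using N.r_coset_hom_Mod N.factorgroup_is_group N.is_group
      by (auto simp: group_hom_def group_hom_axioms_def)
    interpret P: profinite_group "G\<lparr>carrier := P\<rparr>" "subtopology T P"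
      by (rule compact_subgroup_profinite[OF P(1) Pcomp])
    have Ns: "subgroup N G" using N P(1) normal_imp_subgroup subgroup_restrictD by blast
    have NP: "N \<subseteq> P" using N.subset by simp
    have fin: "finite (carrier (G\<lparr>carrier := P\<rparr> Mod N))"
      using finite_cosets[OF P(1) Pcomp Ns No] by (simp add: carrier_FactGroup)
    then have "order (G\<lparr>carrier := P\<rparr> Mod N) > 0" using F.order_gt_0_iff_finite by blast
    then obtain a m where am: "\<not> p dvd m" "order (G\<lparr>carrier := P\<rparr> Mod N) = m * p ^ a"
      using prime_power_canonical[OF p] by metis
    then obtain S' where S': "subgroup S' (G\<lparr>carrier := P\<rparr> Mod N)" "card S' = p ^ a"
      using sylow_thm[OF p F.is_group _ fin, of a m] by (auto simp: mult.commute)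
    define S where "S = {x \<in> P. N #> x \<in> S'}"
    have "subgroup S (G\<lparr>carrier := P\<rparr>)"
    proof (rule N.subgroupI)
      show "S \<subseteq> carrier (G\<lparr>carrier := P\<rparr>)" unfolding S_def by auto
      show "S \<noteq> {}" using h.hom_one subgroup.one_closed[OF S'(1)] subgroup.one_closed[OF P(1)]
        unfolding S_def by force
      show "inv\<^bsub>G\<lparr>carrier := P\<rparr>\<^esub> x \<in> S" if "x \<in> S" for x
        using that h.hom_inv[of x] subgroup.m_inv_closed[OF S'(1)] N.inv_closed[of x] unfolding S_def by auto
      show "x \<otimes>\<^bsub>G\<lparr>carrier := P\<rparr>\<^esub> y \<in> S" if "x \<in> S" "y \<in> S" for x y
        using that h.hom_mult[of x y] subgroup.m_closed[OF S'(1)] N.m_closed[of x y] unfolding S_def by auto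
    qed
    note Sr = this
    have S: "subgroup S G" by (rule subgroup_restrictD[OF P(1) Sr])
    have SP: "S \<subseteq> P" unfolding S_def by blast
    have NS: "N \<subseteq> S"
    proof
      fix x assume x: "x \<in> N"
      then have "N #> x = N" using Ns subgroup.mem_carrier by (intro coset_join2) auto
      then show "x \<in> S" using x NP subgroup.one_closed[OF S'(1)] unfolding S_def by auto
    qed
    have img: "(\<lambda>x. N #> x) ` S = S'"
      using subgroup.subset[OF S'(1)] unfolding S_def by (auto simp: carrier_FactGroup)
    have "rel_index P N = rel_index P S * rel_index S N" by (rule rel_index_mult[OF P(1) S SP Ns NS])
    moreover have "rel_index S N = p ^ a" using img S'(2) unfolding rel_index_def by simp
    ultimately have "rel_index P S = m"
      using am(2) p unfolding rel_index_FactGroup[of P N] by (simp add: prime_gt_0_nat)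
    then have full: "p_full p K S" using p_full_subgroup[OF p P(1,4) S SP] am(1) by simp
    have "openin (subtopology T P) S"
      using P.openin_subgroupI[OF Sr No NS] subgroup.one_closed[OF Ns] by simp
    then have "closedin (subtopology T P) S" by (rule P.closedin_open_subgroup[OF Sr])
    then have "closedin T S" using P(2) closedin_trans_full by blast
    then have "S = P" using min[OF S _ SP full] by simp
    then have "order (G\<lparr>carrier := P\<rparr> Mod N) = p ^ a"
      using img S'(2) by (simp add: order_def carrier_FactGroup)
    then have "finite_pi_group {p} (G\<lparr>carrier := P\<rparr> Mod N)"
      using fin F.is_group p unfolding finite_pi_group_def
      by (auto dest: prime_dvd_power primes_dvd_imp_eq)
    then show ?thesis
      using N.finite_pi_group_FactGroup[OF fin] pi_quotient_restrict[OF P(1)] by simp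
  qed
  then show ?thesis using pro_pi_iff[OF P(1) Pcomp] by blast
qed

text \<open>Fullness is the lower bound on the size of a Sylow subgroup, and minimality cuts the
  group down to a pro-\<open>p\<close> one; Zorn's lemma provides a minimal full subgroup.\<close>

lemma ex_sylow_pro_p_subgroup:
  assumes K: "subgroup K G" "compactin T K" and p: "prime p"
  obtains P where "subgroup P G" "P \<subseteq> K" "p_full p K P"
    "pro_pi {p} (G\<lparr>carrier := P\<rparr>) (subtopology T P)"
proof -
  define A where "A = {H. subgroup H G \<and> closedin T H \<and> H \<subseteq> K \<and> p_full p K H}"
  have KA: "K \<in> A"
    using K compactin_imp_closedin[OF Hausdorff K(2)] unfolding A_def p_full_def by simp
  have "\<exists>P\<in>A. \<forall>H\<in>A. H \<subseteq> P \<longrightarrow> H = P"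
  \<comment> \<open>The order is reversed: maximal elements are minimal subgroups, and a chain is
    bounded by its intersection.\<close>
  proof (rule predicate_Zorn[of A "\<lambda>x y. y \<subseteq> x"])
    show "partial_order_on A (relation_of (\<lambda>x y. y \<subseteq> x) A)"
      by (rule partial_order_on_relation_ofI) auto
    fix C assume C: "C \<in> Chains (relation_of (\<lambda>x y. y \<subseteq> x) A)"
    show "\<exists>u\<in>A. \<forall>a\<in>C. u \<subseteq> a"
    proof (cases "C = {}")
      case True
      then show ?thesis using KA by blast
    next
      case False
      have CA: "C \<subseteq> A" using C unfolding Chains_def relation_of_def by blast
      have "p_full p K (\<Inter>C)"
      proof (rule p_full_Inter_chain[OF K False])
        show "subgroup H G \<and> closedin T H \<and> H \<subseteq> K \<and> p_full p K H" if "H \<in> C" for H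
          using that CA unfolding A_def by blast
        show "H \<subseteq> H' \<or> H' \<subseteq> H" if "H \<in> C" "H' \<in> C" for H H'
          using that C unfolding Chains_def relation_of_def by blast
      qed
      moreover have "subgroup (\<Inter>C) G" using False CA unfolding A_def by (intro subgroups_Inter) auto
      moreover have "closedin T (\<Inter>C)" using False CA unfolding A_def by (intro closedin_Inter) auto
      moreover have "\<Inter>C \<subseteq> K" using False CA unfolding A_def by blast
      ultimately have "\<Inter>C \<in> A" unfolding A_def by blast
      then show ?thesis by blast
    qed
  qed
  then obtain P where P: "P \<in> A" "\<And>H. H \<in> A \<Longrightarrow> H \<subseteq> P \<Longrightarrow> H = P" by blast
  have P': "subgroup P G" "closedin T P" "P \<subseteq> K" "p_full p K P" using P(1) unfolding A_def by auto
  have "pro_pi {p} (G\<lparr>carrier := P\<rparr>) (subtopology T P)"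
  proof (rule minimal_p_full_pro_p[OF K p P'])
    show "H = P" if "subgroup H G" "closedin T H" "H \<subseteq> P" "p_full p K H" for H
      using P(2) that P'(3) unfolding A_def by blast
  qed
  then show ?thesis using that P' by blast
qed

text \<open>\<open>P\<close> meets \<open>V\<close> and \<open>V'\<close> trivially, so it has the
  same index over both. Over \<open>V\<close> this index divides that of \<open>K\<close>; over
  \<open>V'\<close> it carries the full power of \<open>p\<close> in that of \<open>K\<close>. Hence
  passing from \<open>V\<close> to \<open>V'\<close> adds no factor \<open>p\<close>.\<close>

lemma p_full_Int_trivial_imp_prime_to_p:
  assumes K: "subgroup K G" "compactin T K" and p: "prime p"
    and P: "subgroup P G" "P \<subseteq> K" "p_full p K P"
    and V: "subgroup V G" "openin T V" "\<And>x. x \<in> K \<Longrightarrow> cj x ` V = V" "P \<inter> V = {\<one>}"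
    and V': "subgroup V' G" "openin T V'" "\<And>x. x \<in> K \<Longrightarrow> cj x ` V' = V'" "V' \<subseteq> V"
  shows "pi_quotient {q. prime q \<and> q \<noteq> p} (K \<inter> V) V'"
proof -
  have KV: "subgroup (K \<inter> V) G" and KV': "subgroup (K \<inter> V') G"
    using K(1) V(1) V'(1) by (auto intro: subgroups_Inter_pair)
  have nKV: "K \<inter> V \<lhd> G\<lparr>carrier := K\<rparr>"
    using normal_in_subgroup_iff[OF K(1) KV] V(3) cj_image_self[OF K(1)] by blast
  have nKV': "K \<inter> V' \<lhd> G\<lparr>carrier := K \<inter> V\<rparr>"
    using normal_in_subgroup_iff[OF KV KV'] V'(3,4) cj_image_self[OF K(1)] by blast
  define i where "i = rel_index (K \<inter> V) (K \<inter> V')"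
  have KVcomp: "compactin T (K \<inter> V)"
    using closedin_compact_subset[OF K(2) closedin_Int[OF compactin_imp_closedin[OF Hausdorff K(2)]
      closedin_open_subgroup[OF V(1,2)]]] by simp
  have "openin (subtopology T (K \<inter> V)) ((K \<inter> V) \<inter> V')" by (rule openin_subtopology_Int2[OF V'(2)])
  moreover have "(K \<inter> V) \<inter> V' = K \<inter> V'" using V'(4) by blast
  ultimately have fin: "finite ((\<lambda>x. (K \<inter> V') #> x) ` (K \<inter> V))"
    using finite_cosets[OF KV KVcomp KV'] by simp
  have "\<not> p dvd i"
  proof
    assume pi: "p dvd i"
    have "rel_index K V > 0"
      using finite_cosets_open[OF K V(1,2)] subgroup.one_closed[OF K(1)]
      unfolding rel_index_def by (auto simp: card_gt_0_iff)
    then obtain k n where kn: "\<not> p dvd n" "rel_index K V = n * p ^ k"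
      using prime_power_canonical[OF p] by metis
    have "rel_index K V' = rel_index K V * i"
      using rel_index_mult[OF K(1) KV _ KV'] rel_index_Int[OF K(1) V(1)] rel_index_Int[OF K(1) V'(1)] V'(4)
      unfolding i_def by auto
    \<comment> \<open>\<open>p ^ k\<close> is the exact power of \<open>p\<close> in
      \<open>rel_index K V\<close>, so a single further factor is contradictory.\<close>
    then have "p ^ Suc k dvd rel_index K V'" using kn(2) pi by (auto intro: mult_dvd_mono)
    then have "p ^ Suc k dvd rel_index P V'" using P(3) V' unfolding p_full_def by blast
    moreover have "P \<inter> V' = {\<one>}" using V(4) V'(4) subgroup.one_closed[OF P(1)] subgroup.one_closed[OF V'(1)] by blast
    then have "rel_index P V' = rel_index P (K \<inter> V)"
      using rel_index_Int[OF P(1) V'(1)] rel_index_Int[OF P(1) KV] V(4) P(2)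
      by (metis inf.absorb1 inf_assoc)
    moreover have "rel_index P (K \<inter> V) dvd rel_index K (K \<inter> V)"
      by (rule rel_index_dvd[OF K(1) nKV P(1,2)])
    ultimately have "p ^ Suc k dvd n * p ^ k"
      using kn(2) rel_index_Int[OF K(1) V(1)] by (metis dvd_trans)
    then show False using kn(1) p by (simp add: prime_gt_0_nat)
  qed
  then have "finite_pi_group {q. prime q \<and> q \<noteq> p} (G\<lparr>carrier := K \<inter> V\<rparr> Mod (K \<inter> V'))"
    using fin normal.factorgroup_is_group[OF nKV'] unfolding i_def rel_index_FactGroup
    by (auto simp: finite_pi_group_def carrier_FactGroup)
  then have "pi_quotient {q. prime q \<and> q \<noteq> p} (K \<inter> V) (K \<inter> V')"
    using normal.finite_pi_group_FactGroup[OF nKV'] fin pi_quotient_restrict[OF KV]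
    by (simp add: carrier_FactGroup)
  then show ?thesis unfolding pi_quotient_def by blast
qed

text \<open>If \<open>x\<close> were non-trivial, some open subgroup \<open>V\<close> would miss it
  and yet contain a power of \<open>x\<close> with exponent prime to \<open>p\<close> and one with
  exponent a power of \<open>p\<close>; by Bezout \<open>V\<close> would contain
  \<open>x\<close>.\<close>

lemma pro_p_Int_prime_to_p_trivial:
  assumes P: "subgroup P G" "compactin T P" "pro_pi {p} (G\<lparr>carrier := P\<rparr>) (subtopology T P)"
    and W: "\<And>N. subgroup N G \<Longrightarrow> openin T N \<Longrightarrow> pi_quotient {q. prime q \<and> q \<noteq> p} W N"
    and x: "x \<in> P" "x \<in> W"
  shows "x = \<one>"
proof (rule ccontr)
  assume "x \<noteq> \<one>"
  moreover have xc: "x \<in> carrier G" using x(1) P(1) subgroup.mem_carrier by metis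
  ultimately obtain V where V: "subgroup V G" "openin T V" "x \<notin> V" using ex_compact_open_subgroup by metis
  obtain m :: nat where m: "m > 0" "\<forall>q. prime q \<and> q dvd m \<longrightarrow> q \<noteq> p" "x [^] m \<in> V"
    using W[OF V(1,2)] x(2) unfolding pi_quotient_def by blast
  have one: "\<one> \<in> P" by (rule subgroup.one_closed[OF P(1)])
  \<comment> \<open>The pro-\<open>p\<close> condition tests only normal subgroups of
    \<open>P\<close>, so \<open>V\<close> is replaced by its core.\<close>
  have C: "subgroup (core P V) G" "openin T (core P V)"
    using P V subgroup.subset[OF P(1)] one by (auto intro!: core_subgroup core_openin)
  have PC: "subgroup (P \<inter> core P V) G" using P(1) C(1) by (rule subgroups_Inter_pair)
  have "P \<inter> core P V \<lhd> G\<lparr>carrier := P\<rparr>"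
    using normal_in_subgroup_iff[OF P(1) PC] cj_image_self[OF P(1)]
      core_normalised[OF P(1) subgroup.subset[OF V(1)]] by blast
  moreover have "openin (subtopology T P) (P \<inter> core P V)" by (rule openin_subtopology_Int2[OF C(2)])
  ultimately have "pi_quotient {p} P (P \<inter> core P V)" using pro_pi_iff[OF P(1,2)] P(3) by blast
  then obtain k :: nat where k: "k > 0" "\<forall>q. prime q \<and> q dvd k \<longrightarrow> q = p" "x [^] k \<in> core P V"
    using x(1) unfolding pi_quotient_def by blast
  have kV: "x [^] k \<in> V" using k(3) core_subset[OF one subgroup.subset[OF V(1)]] by blast
  have pow: "y [^] (j::nat) \<in> V" if "y \<in> V" for y j
    using that V(1) by (induction j) (auto intro: subgroup.one_closed subgroup.m_closed)
  have "coprime m k"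
  proof (rule ccontr)
    assume "\<not> coprime m k"
    then obtain c where "c dvd m" "c dvd k" "c \<noteq> 1" by (auto elim: not_coprimeE)
    then obtain q where "prime q" "q dvd m" "q dvd k" using prime_factor_nat dvd_trans by metis
    then show False using m(2) k(2) by blast
  qed
  \<comment> \<open>Bezout over the naturals, with the \<open>+ 1\<close> on the side of
    \<open>k\<close>, is applied for \<open>k \<noteq> 1\<close>; with \<open>k = 1\<close> the
    point \<open>x\<close> would lie in \<open>V\<close> at once.\<close>
  moreover have "k \<noteq> 1" using kV V(3) xc by (auto simp: nat_pow_eone)
  ultimately obtain a b where "m * a = k * b + 1"
    using coprime_bezout_strong[of m k] by blast
  then have "x [^] (m * a) = x [^] (k * b) \<otimes> x" by simp
  moreover have "x [^] (m * a) \<in> V" "x [^] (k * b) \<in> V"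
    using pow[OF m(3), of a] pow[OF kV, of b] xc by (simp_all add: nat_pow_pow)
  ultimately have "inv (x [^] (k * b)) \<otimes> (x [^] (k * b) \<otimes> x) \<in> V"
    using V(1) by (metis subgroup.m_closed subgroup.m_inv_closed)
  moreover have "inv (x [^] (k * b)) \<otimes> (x [^] (k * b) \<otimes> x) = x"
    using xc by (simp add: m_assoc[symmetric])
  ultimately show False using V(3) by simp
qed

end

section \<open>The local prime content\<close>

context class_S
begin

theorem locally_normal_infinite_pro_p:
  assumes p: "p \<in> local_prime_content G T"
    and L: "locally_normal G T L" "closedin T L" "L \<noteq> {\<one>}"
  shows "\<exists>P. subgroup P G \<and> P \<subseteq> L \<and> infinite P \<and> pro_pi {p} (G\<lparr>carrier := P\<rparr>) (subtopology T P)"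
proof (rule ccontr)
  assume no: "\<not> ?thesis"
  obtain R where prime: "prime p" and R: "subgroup R G" "infinite R"
      "pro_pi {p} (G\<lparr>carrier := R\<rparr>) (subtopology T R)"
    using p unfolding local_prime_content_def by blast
  have "compact_space (subtopology T R)"
    using R(3) profinite_group.compact unfolding pro_pi_def pro_class_def by blast
  moreover have "R \<subseteq> topspace T" using subgroup.subset[OF R(1)] topspace_eq by simp
  ultimately have Rcomp: "compactin T R" by (simp add: compactin_subspace)
  have Ls: "subgroup L G" using L(1) unfolding locally_normal_def by simp
  have Lc: "L \<subseteq> carrier G" by (rule subgroup.subset[OF Ls])
  obtain x where "x \<in> carrier G" "x \<noteq> \<one>"
    using topologically_simple one_closed unfolding topologically_simple_def by blast
  then obtain U where U: "subgroup U G" "openin T U" "compactin T U" using ex_compact_open_subgroup by metis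
  have Uc: "U \<subseteq> carrier G" by (rule subgroup.subset[OF U(1)])
  \<comment> \<open>\<open>L\<close> is only closed, whereas the Sylow argument asks for a compact
    group.\<close>
  define K where "K = L \<inter> U"
  have K: "subgroup K G" unfolding K_def using Ls U(1) by (rule subgroups_Inter_pair)
  have Kcomp: "compactin T K"
    unfolding K_def using closedin_compact_subset[OF U(3)
      closedin_Int[OF L(2) closedin_open_subgroup[OF U(1,2)]]] by simp
  obtain P where P: "subgroup P G" "P \<subseteq> K" "p_full p K P"
      "pro_pi {p} (G\<lparr>carrier := P\<rparr>) (subtopology T P)"
    using ex_sylow_pro_p_subgroup[OF K Kcomp prime] .
  then have Pfin: "finite P" using no unfolding K_def by blast
  have Pc: "P \<subseteq> carrier G" by (rule subgroup.subset[OF P(1)])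
  have "\<exists>V. subgroup V G \<and> openin T V \<and> x \<notin> V" if "x \<in> P - {\<one>}" for x
    using ex_compact_open_subgroup[of x] that Pc by (metis DiffE insertI1 subsetD)
  then obtain f where f: "\<And>x. x \<in> P - {\<one>} \<Longrightarrow> subgroup (f x) G \<and> openin T (f x) \<and> x \<notin> f x" by metis
  \<comment> \<open>As \<open>P\<close> is finite, finitely many open subgroups exclude all its
    non-trivial elements, and \<open>V0\<close> stays open.\<close>
  define V0 where "V0 = \<Inter>(insert U (f ` (P - {\<one>})))"
  have V0: "subgroup V0 G" unfolding V0_def by (rule subgroups_Inter) (use f U in auto)
  have V0o: "openin T V0" unfolding V0_def by (rule openin_Inter) (use f U Pfin in auto)
  have V0P: "P \<inter> V0 \<subseteq> {\<one>}" unfolding V0_def using f by blast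
  define V where "V = core U V0"
  have V: "subgroup V G" "openin T V"
    unfolding V_def using V0 V0o U Uc subgroup.one_closed[OF U(1)] by (auto intro!: core_subgroup core_openin)
  have VV0: "V \<subseteq> V0"
    unfolding V_def by (rule core_subset[OF subgroup.one_closed[OF U(1)] subgroup.subset[OF V0]])
  have VU: "V \<subseteq> U" using VV0 unfolding V0_def by blast
  have UV: "cj u ` V = V" if "u \<in> U" for u
    unfolding V_def by (rule core_normalised[OF U(1) subgroup.subset[OF V0] that])
  have PV: "P \<inter> V = {\<one>}"
    using V0P VV0 subgroup.one_closed[OF P(1)] subgroup.one_closed[OF V(1)] by blast
  have Vcomp: "compactin T V" by (rule closedin_compact_subset[OF U(3) closedin_open_subgroup[OF V] VU])
  have LV: "L \<inter> V = K \<inter> V" using VU unfolding K_def by blast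
  have LVs: "subgroup (L \<inter> V) G" using Ls V(1) by (rule subgroups_Inter_pair)
  have "locally_normal G T (L \<inter> V)"
  proof -
    define M where "M = {g \<in> carrier G. cj g ` L = L}"
    have M: "subgroup M G" "openin T M"
      using normaliser_subgroup[OF Lc] normalizer_eq[OF Lc] L(1) unfolding M_def locally_normal_def by auto
    have MU: "subgroup (M \<inter> U) G" using M(1) U(1) by (rule subgroups_Inter_pair)
    have "M \<inter> U \<subseteq> {g \<in> carrier G. cj g ` (L \<inter> V) = L \<inter> V}"
    proof
      fix g assume g: "g \<in> M \<inter> U"
      have "cj g ` (L \<inter> V) = L \<inter> V"
      proof (rule cj_image_normalised[OF MU subgroup.subset[OF LVs] _ g])
        show "cj k ` (L \<inter> V) \<subseteq> L \<inter> V" if "k \<in> M \<inter> U" for k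
          using that UV[of k] unfolding M_def by blast
      qed
      then show "g \<in> {g \<in> carrier G. cj g ` (L \<inter> V) = L \<inter> V}" using g Uc by blast
    qed
    then have "openin T {g \<in> carrier G. cj g ` (L \<inter> V) = L \<inter> V}"
      using openin_subgroupI[OF normaliser_subgroup[OF subgroup.subset[OF LVs]] openin_Int[OF M(2) U(2)]]
        subgroup.one_closed[OF MU] by blast
    then show ?thesis
      using LVs normalizer_eq[OF subgroup.subset[OF LVs]] unfolding locally_normal_def by simp
  qed
  moreover have "compactin T (L \<inter> V)"
    using closedin_compact_subset[OF Vcomp closedin_Int[OF L(2) closedin_open_subgroup[OF V]]] by simp
  \<comment> \<open>Shrinking \<open>L\<close> to \<open>V\<close> might have lost everything; this
    is what \<open>locally_normal_Int_open\<close> rules out.\<close>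
  moreover have "L \<inter> V \<noteq> {\<one>}" by (rule locally_normal_Int_open[OF L(1,3) V Vcomp])
  ultimately have LV3: "locally_normal G T (L \<inter> V)" "compactin T (L \<inter> V)" "L \<inter> V \<noteq> {\<one>}" by auto
  interpret Q: class_S_section_class G T "pi_quotient {q. prime q \<and> q \<noteq> p}"
    by (intro class_S_section_class.intro class_S_axioms section_class_pi)
  have proLV: "Q.pro (L \<inter> V)"
    unfolding Q.pro_def
  proof (intro allI impI, elim conjE)
    fix N assume N: "subgroup N G" "openin T N"
    have NV: "subgroup (N \<inter> V) G" "openin T (N \<inter> V)" using N V by (auto intro: subgroups_Inter_pair)
    have oneK: "\<one> \<in> K" by (rule subgroup.one_closed[OF K])
    \<comment> \<open>\<open>N\<close> is any open test group; the index count asks for one that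
      lies in \<open>V\<close> and is invariant under \<open>K\<close>.\<close>
    have C: "subgroup (core K (N \<inter> V)) G" "openin T (core K (N \<inter> V))"
      using NV K Kcomp subgroup.subset[OF K] oneK by (auto intro!: core_subgroup core_openin)
    have sub: "core K (N \<inter> V) \<subseteq> N \<inter> V" by (rule core_subset[OF oneK subgroup.subset[OF NV(1)]])
    have "pi_quotient {q. prime q \<and> q \<noteq> p} (K \<inter> V) (core K (N \<inter> V))"
    proof (rule p_full_Int_trivial_imp_prime_to_p[OF K Kcomp prime P(1-3) V _ PV C])
      show "cj x ` V = V" if "x \<in> K" for x using that UV unfolding K_def by blast
      show "cj x ` core K (N \<inter> V) = core K (N \<inter> V)" if "x \<in> K" for x
        by (rule core_normalised[OF K subgroup.subset[OF NV(1)] that])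
    qed (use sub in blast)
    then show "pi_quotient {q. prime q \<and> q \<noteq> p} (L \<inter> V) N" using Q.Q_super sub LV by auto
  qed
  obtain W where W: "subgroup W G" "openin T W"
      "\<And>N. subgroup N G \<Longrightarrow> openin T N \<Longrightarrow> pi_quotient {q. prime q \<and> q \<noteq> p} W N"
    using Q.locally_pro[OF LV3 proLV U] by auto
  obtain F where F: "finite F" "F \<subseteq> R" "R \<subseteq> (\<Union>f\<in>F. (\<otimes>) f ` W)"
    using compactin_open_cosets[OF Rcomp W(2) subgroup.one_closed[OF W(1)]] .
  \<comment> \<open>\<open>R\<close> meets \<open>W\<close> trivially, so each of the finitely many
    cosets of \<open>W\<close> covering \<open>R\<close> contains one element of \<open>R\<close>,
    its representative.\<close>
  have "R \<subseteq> F"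
  proof
    fix x assume x: "x \<in> R"
    then obtain f w where fw: "f \<in> F" "w \<in> W" "x = f \<otimes> w" using F(3) by auto
    have c: "f \<in> carrier G" "w \<in> carrier G"
      using fw F(2) subgroup.subset[OF R(1)] subgroup.subset[OF W(1)] by auto
    have "w = inv f \<otimes> x" using fw(3) c by (simp add: m_assoc[symmetric])
    then have "w \<in> R" using x fw(1) F(2) R(1) by (auto intro: subgroup.m_closed subgroup.m_inv_closed)
    then have "w = \<one>" using pro_p_Int_prime_to_p_trivial[OF R(1) Rcomp R(3) W(3)] fw(2) by blast
    then show "x \<in> F" using fw c by simp
  qed
  then show False using F(1) R(2) finite_subset by blast
qed

end

theorem theorem7:
  fixes G :: "('a, 'b) monoid_scheme" and T :: "'a topology"
  assumes "class_S G T"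
  shows
    "(\<forall>\<pi> :: nat set. (\<forall>p\<in>\<pi>. prime p) \<longrightarrow>
        (\<exists>L. locally_normal G T L \<and> compactin T L \<and> L \<noteq> {\<one>\<^bsub>G\<^esub>} \<and>
             pro_pi \<pi> (G\<lparr>carrier := L\<rparr>) (subtopology T L)) \<longrightarrow>
        (\<forall>U. subgroup U G \<and> compactin T U \<and> openin T U \<longrightarrow>
             virtually (pro_pi \<pi>) (G\<lparr>carrier := U\<rparr>) (subtopology T U))) \<and>
     (\<forall>p \<in> local_prime_content G T. \<forall>L.
        locally_normal G T L \<and> closedin T L \<and> L \<noteq> {\<one>\<^bsub>G\<^esub>} \<longrightarrow>
        (\<exists>P. subgroup P G \<and> P \<subseteq> L \<and> infinite P \<and>
             pro_pi {p} (G\<lparr>carrier := P\<rparr>) (subtopology T P))) \<and>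
     ((\<exists>L. locally_normal G T L \<and> compactin T L \<and> L \<noteq> {\<one>\<^bsub>G\<^esub>} \<and>
           prosoluble (G\<lparr>carrier := L\<rparr>) (subtopology T L)) \<longrightarrow>
      (\<forall>U. subgroup U G \<and> compactin T U \<and> openin T U \<longrightarrow>
           virtually prosoluble (G\<lparr>carrier := U\<rparr>) (subtopology T U)))"
proof -
  interpret class_S G T by fact
  have pi: "class_S_section_class G T (pi_quotient \<pi>)" for \<pi>
    by (intro class_S_section_class.intro class_S_axioms section_class_pi)
  have sol: "class_S_section_class G T soluble_quotient"
    by (intro class_S_section_class.intro class_S_axioms section_class_soluble)
  show ?thesis
    using class_S_section_class.virtually_pro_class[OF pi pro_pi_iff]
      class_S_section_class.virtually_pro_class[OF sol prosoluble_iff]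
      locally_normal_infinite_pro_p
    by blast
qed

end
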